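(* (i) The codensity monad $\mathbb{T}^U$ of the forgetful functor $U\colon \mathbb{C}\to\mathbf{Meas}$ is isomorphic (as a monad on $\mathbf{Meas}$) to the finitely additive Giry monad $\mathbb{F}$. (ii) The codensity monad $\mathbb{T}^V$ of the forgetful functor $V\colon\mathbb{D}\to\mathbf{Meas}$ is isomorphic (as a monad on $\mathbf{Meas}$) to the Giry monad $\mathbb{G}$.
   Context: $I=[0,1]$ with its Borel $\sigma$-algebra. $\mathbf{Meas}$ is the category of measurable spaces (sets equipped with a $\sigma$-algebra) and measurable maps. Categories and functors. A map $h\colon c\to c'$ between convex subsets of real vector spaces is affine if $h(rx+(1-r)y)=rh(x)+(1-r)h(y)$ for all $x,y\in c$, $r\in I$. Let $c_0$ be the real vector space of real sequences converging to $0$, and $d_0\subseteq c_0$ the convex set of those sequences all of whose terms lie in $I$. $\mathbb{C}$ is the category whose objects are the finite powers $I^n$ ($n\ge 0$, with $I^0=1$ the one-point set) and whose morphisms are all affine maps between them. $\mathbb{D}$ is the category whose objects are the finite powers $I^n$ ($n\geq 0$) together with $d_0$, and whose morphisms are all affine maps between them. Each object is made a measurable space as a subspace of a product of copies of $I$ ($I^n$ with the product $\sigma$-algebra, $d_0$ as a subspace of $I^{\mathbb{N}}$ with the product $\sigma$-algebra). All morphisms of $\mathbb{D}$ are then measurable, which gives the forgetful functors $U\colon\mathbb{C}\to\mathbf{Meas}$ and $V\colon\mathbb{D}\to\mathbf{Meas}$. Giry monads. A finitely additive probability measure on $(\Omega,\Sigma)$ is $\pi\colon\Sigma\to I$ with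 $\pi(\Omega)=1$ and $\pi(A\cup B)=\pi(A)+\pi(B)$ for disjoint $A,B\in\Sigma$; it is a probability measure if it is moreover countably additive. For a finitely additive probability measure $\pi$ and measurable $f\colon\Omega\to I$, $\int_\Omega f\,d\pi$ is the supremum of $\int_\Omega f'\,d\pi$ over simple functions $f'\le f$, where $\int_\Omega \sum_i a_i\chi_{A_i}\,d\pi=\sum_i a_i\pi(A_i)$. $F\Omega$ is the set of finitely additive probability measures on $\Omega$ with the smallest $\sigma$-algebra making every $\mathrm{ev}_A\colon F\Omega\to I$, $\pi\mapsto\pi(A)$ ($A$ measurable), measurable; $G\Omega\subseteq F\Omega$ is the subspace of probability measures. For measurable $g\colon\Omega\to\Omega'$, $Fg(\pi)(A')=\pi(g^{-1}(A'))$, and $Gg$ is the restriction of $Fg$. The unit and multiplication are $\eta_\Omega(\omega)(A)=\chi_A(\omega)$ and $\mu_\Omega(\rho)(A)=\int_{F\Omega}\mathrm{ev}_A\,d\rho$ for $\rho \in FF\Omega$ (respectively $\int_{G\Omega}\mathrm{ev}_A\,d\rho$ for $\rho\in GG\Omega$). These give monads $\mathbb{F}$ (the finitely additive Giry monad) and $\mathbb{G}$ (the Giry monad) on $\mathbf{Meas}$. Codensity monad. For a functor $W\colon\mathbb{A}\to\mathcal{M}$ with $\mathbb{A}$ small and $\mathcal{M}$ complete and locally small, let $(T^W,\kappa\colon T^WW\to W)$ be the right Kan extension of $W$ along itself: for every $H\colon\mathcal{M}\to\mathcal{M}$ and $\lambda\colon HW\to W$ there is a unique $\tau\colon H\to T^W$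 with $\kappa\circ\tau W=\lambda$. The codensity monad $\mathbb{T}^W=(T^W,\eta,\mu)$ has $\eta$ and $\mu$ determined by $\kappa\circ\eta W=\mathrm{id}_W$ and $\kappa\circ\mu W=\kappa\circ T^W\kappa$. Equivalently, $T^Wm=\int_{a\in\mathbb{A}}[\mathcal{M}(m,Wa),Wa]$ (an end of powers), with limit projections $\mathrm{ev}_f\colon T^Wm\to Wa$ for $f\colon m\to Wa$, and $\mathrm{ev}_f\circ T^Wg=\mathrm{ev}_{f\circ g}$, $\mathrm{ev}_f\circ\eta_m=f$, $\mathrm{ev}_f\circ\mu_m=\mathrm{ev}_{\mathrm{ev}_f}$. *)

theory Defs
  imports "HOL-Probability.Probability"
begin

section \<open>Measurable spaces and measurable maps\<close>

text \<open>
  An object of \<open>Meas\<close> is a value \<open>M :: 'a measure\<close>, of which only \<open>space M\<close> and \<open>sets M\<close> are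
  used. Morphisms are normalised outside the domain, so that equality of functions is equality
  of morphisms; composition is \<^const>\<open>compose\<close>.
\<close>

definition meas_hom :: "'a measure \<Rightarrow> 'b measure \<Rightarrow> ('a \<Rightarrow> 'b) set" where
  "meas_hom M N = (M \<rightarrow>\<^sub>M N) \<inter> extensional (space M)"

definition meas_iso :: "'a measure \<Rightarrow> 'b measure \<Rightarrow> ('a \<Rightarrow> 'b) \<Rightarrow> bool" where
  "meas_iso M N \<theta> \<longleftrightarrow> \<theta> \<in> M \<rightarrow>\<^sub>M N \<and>
     (\<exists>\<theta>' \<in> N \<rightarrow>\<^sub>M M. (\<forall>x\<in>space M. \<theta>' (\<theta> x) = x) \<and> (\<forall>y\<in>space N. \<theta> (\<theta>' y) = y))"

lemma meas_homI: "f \<in> M \<rightarrow>\<^sub>M N \<Longrightarrow> f \<in> extensional (space M) \<Longrightarrow> f \<in> meas_hom M N"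
  by (simp add: meas_hom_def)

lemma meas_hom_measurable: "f \<in> meas_hom M N \<Longrightarrow> f \<in> M \<rightarrow>\<^sub>M N"
  by (simp add: meas_hom_def)

lemma meas_hom_space: "f \<in> meas_hom M N \<Longrightarrow> x \<in> space M \<Longrightarrow> f x \<in> space N"
  by (auto simp: meas_hom_def measurable_space)

lemma meas_hom_restrict: "f \<in> M \<rightarrow>\<^sub>M N \<Longrightarrow> (\<lambda>x\<in>space M. f x) \<in> meas_hom M N"
  by (intro meas_homI restrict_extensional) (simp cong: measurable_cong)

lemma meas_hom_id: "(\<lambda>x\<in>space M. x) \<in> meas_hom M M"
  by (rule meas_hom_restrict) simp

lemma meas_hom_compose:
  assumes "f \<in> meas_hom L M" "g \<in> M \<rightarrow>\<^sub>M N"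
  shows "compose (space L) g f \<in> meas_hom L N"
  unfolding compose_def
  by (rule meas_hom_restrict) (rule measurable_compose[OF meas_hom_measurable[OF assms(1)] assms(2)])

lemma meas_hom_eqI:
  assumes "f \<in> meas_hom M N" "g \<in> meas_hom M N" "\<And>x. x \<in> space M \<Longrightarrow> f x = g x"
  shows "f = g"
  using assms by (auto simp: meas_hom_def intro: extensionalityI)


section \<open>Codensity monads\<close>

text \<open>
  A forgetful functor \<open>W\<close> from a category of structured measurable spaces: \<open>Und W a\<close> is the
  measurable space underlying the object \<open>a\<close>, and \<open>Arr W a b\<close> is the set of underlying maps of
  the morphisms \<open>a \<rightarrow> b\<close> (only their values on \<open>space (Und W a)\<close> matter).
\<close>

record ('o, 'w) concrete_functor =
  Obj :: "'o set"
  Arr :: "'o \<Rightarrow> 'o \<Rightarrow> ('w \<Rightarrow> 'w) set"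
  Und :: "'o \<Rightarrow> 'w measure"

definition codensity_index :: "('o, 'w) concrete_functor \<Rightarrow> 'a measure \<Rightarrow> ('o \<times> ('a \<Rightarrow> 'w)) set" where
  "codensity_index W \<Omega> = (SIGMA a:Obj W. meas_hom \<Omega> (Und W a))"

text \<open>
  The end \<open>\<integral>\<^sub>a [Meas(\<Omega>, W a), W a]\<close>, as a subspace of the product of all the powers.
\<close>

definition codensity ::
    "('o, 'w) concrete_functor \<Rightarrow> 'a measure \<Rightarrow> ('o \<times> ('a \<Rightarrow> 'w) \<Rightarrow> 'w) measure" where
  "codensity W \<Omega> =
     restrict_space (\<Pi>\<^sub>M (a, f) \<in> codensity_index W \<Omega>. Und W a)
       {t. \<forall>a\<in>Obj W. \<forall>b\<in>Obj W. \<forall>h\<in>Arr W a b. \<forall>f\<in>meas_hom \<Omega> (Und W a).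
             t (b, compose (space \<Omega>) h f) = h (t (a, f))}"

definition codensity_ev ::
    "('o, 'w) concrete_functor \<Rightarrow> 'a measure \<Rightarrow> 'o \<Rightarrow> ('a \<Rightarrow> 'w) \<Rightarrow> ('o \<times> ('a \<Rightarrow> 'w) \<Rightarrow> 'w) \<Rightarrow> 'w" where
  "codensity_ev W \<Omega> a f = (\<lambda>t\<in>space (codensity W \<Omega>). t (a, f))"

definition codensity_map ::
    "('o, 'w) concrete_functor \<Rightarrow> 'a measure \<Rightarrow> 'b measure \<Rightarrow> ('a \<Rightarrow> 'b) \<Rightarrow>
     ('o \<times> ('a \<Rightarrow> 'w) \<Rightarrow> 'w) \<Rightarrow> ('o \<times> ('b \<Rightarrow> 'w) \<Rightarrow> 'w)" where
  "codensity_map W \<Omega> \<Omega>' g =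
     (\<lambda>t\<in>space (codensity W \<Omega>). \<lambda>(a, f)\<in>codensity_index W \<Omega>'. t (a, compose (space \<Omega>) f g))"

definition codensity_unit ::
    "('o, 'w) concrete_functor \<Rightarrow> 'a measure \<Rightarrow> 'a \<Rightarrow> ('o \<times> ('a \<Rightarrow> 'w) \<Rightarrow> 'w)" where
  "codensity_unit W \<Omega> = (\<lambda>\<omega>\<in>space \<Omega>. \<lambda>(a, f)\<in>codensity_index W \<Omega>. f \<omega>)"

definition codensity_mult ::
    "('o, 'w) concrete_functor \<Rightarrow> 'a measure \<Rightarrow>
     ('o \<times> (('o \<times> ('a \<Rightarrow> 'w) \<Rightarrow> 'w) \<Rightarrow> 'w) \<Rightarrow> 'w) \<Rightarrow> ('o \<times> ('a \<Rightarrow> 'w) \<Rightarrow> 'w)" where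
  "codensity_mult W \<Omega> =
     (\<lambda>\<rho>\<in>space (codensity W (codensity W \<Omega>)).
        \<lambda>(a, f)\<in>codensity_index W \<Omega>. \<rho> (a, codensity_ev W \<Omega> a f))"

text \<open>The counit \<open>\<kappa>\<close> of the Kan extension.\<close>

definition codensity_counit ::
    "('o, 'w) concrete_functor \<Rightarrow> 'o \<Rightarrow> ('o \<times> ('w \<Rightarrow> 'w) \<Rightarrow> 'w) \<Rightarrow> 'w" where
  "codensity_counit W a = codensity_ev W (Und W a) a (\<lambda>x\<in>space (Und W a). x)"

subsection \<open>Universal properties\<close>

lemma space_codensity:
  "t \<in> space (codensity W \<Omega>) \<longleftrightarrow>
     t \<in> extensional (codensity_index W \<Omega>) \<and>
     (\<forall>a\<in>Obj W. \<forall>f\<in>meas_hom \<Omega> (Und W a). t (a, f) \<in> space (Und W a)) \<and>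
     (\<forall>a\<in>Obj W. \<forall>b\<in>Obj W. \<forall>h\<in>Arr W a b. \<forall>f\<in>meas_hom \<Omega> (Und W a).
        t (b, compose (space \<Omega>) h f) = h (t (a, f)))"
  by (auto simp: codensity_def codensity_index_def space_restrict_space space_PiM PiE_iff)

lemma codensity_ev_hom:
  assumes "a \<in> Obj W" "f \<in> meas_hom \<Omega> (Und W a)"
  shows "codensity_ev W \<Omega> a f \<in> meas_hom (codensity W \<Omega>) (Und W a)"
proof -
  have "(\<lambda>t. t (a, f)) \<in> (\<Pi>\<^sub>M (a, f) \<in> codensity_index W \<Omega>. Und W a) \<rightarrow>\<^sub>M Und W a"
    using measurable_component_singleton[of "(a, f)" "codensity_index W \<Omega>" "\<lambda>(a, f). Und W a"] assms
    by (simp add: codensity_index_def)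
  then show ?thesis
    unfolding codensity_ev_def codensity_def
    by (intro meas_hom_restrict measurable_restrict_space1)
qed

text \<open>
  \<open>codensity W \<Omega>\<close> with the maps \<open>codensity_ev W \<Omega> a f\<close> is the end, for test spaces \<open>X\<close> of any type.
\<close>

lemma codensity_ev_dinatural:
  assumes "a \<in> Obj W" "b \<in> Obj W" "h \<in> Arr W a b" "f \<in> meas_hom \<Omega> (Und W a)"
  shows "codensity_ev W \<Omega> b (compose (space \<Omega>) h f) =
         compose (space (codensity W \<Omega>)) h (codensity_ev W \<Omega> a f)"
  using assms by (auto simp: codensity_ev_def compose_def fun_eq_iff space_codensity)

lemma codensity_factor:
  fixes X :: "'x measure" and \<Omega> :: "'a measure" and W :: "('o, 'w) concrete_functor"
  assumes \<alpha>: "\<And>a f. a \<in> Obj W \<Longrightarrow> f \<in> meas_hom \<Omega> (Und W a) \<Longrightarrow> \<alpha> a f \<in> X \<rightarrow>\<^sub>M Und W a"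
    and nat: "\<And>a b h f x. a \<in> Obj W \<Longrightarrow> b \<in> Obj W \<Longrightarrow> h \<in> Arr W a b \<Longrightarrow>
        f \<in> meas_hom \<Omega> (Und W a) \<Longrightarrow> x \<in> space X \<Longrightarrow>
        \<alpha> b (compose (space \<Omega>) h f) x = h (\<alpha> a f x)"
    and W: "\<And>a b h. a \<in> Obj W \<Longrightarrow> b \<in> Obj W \<Longrightarrow> h \<in> Arr W a b \<Longrightarrow> h \<in> Und W a \<rightarrow>\<^sub>M Und W b"
  shows "(\<lambda>x\<in>space X. \<lambda>(a, f)\<in>codensity_index W \<Omega>. \<alpha> a f x) \<in> meas_hom X (codensity W \<Omega>)"
proof (rule meas_hom_restrict)
  have "(\<lambda>x. \<lambda>i\<in>codensity_index W \<Omega>. \<alpha> (fst i) (snd i) x) \<in>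
          X \<rightarrow>\<^sub>M (\<Pi>\<^sub>M (a, f) \<in> codensity_index W \<Omega>. Und W a)"
    by (rule measurable_restrict) (auto simp: codensity_index_def intro: \<alpha>)
  moreover have "(\<lambda>(a, f)\<in>codensity_index W \<Omega>. \<alpha> a f x) =
      (\<lambda>i\<in>codensity_index W \<Omega>. \<alpha> (fst i) (snd i) x)" for x
    by (auto simp: fun_eq_iff)
  ultimately have "(\<lambda>x. \<lambda>(a, f)\<in>codensity_index W \<Omega>. \<alpha> a f x) \<in>
          X \<rightarrow>\<^sub>M (\<Pi>\<^sub>M (a, f) \<in> codensity_index W \<Omega>. Und W a)"
    by simp
  then show "(\<lambda>x. \<lambda>(a, f)\<in>codensity_index W \<Omega>. \<alpha> a f x) \<in> X \<rightarrow>\<^sub>M codensity W \<Omega>"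
    unfolding codensity_def
    by (rule measurable_restrict_space2[rotated])
       (auto simp: codensity_index_def nat meas_hom_compose[OF _ W])
qed

lemma codensity_end_universal:
  fixes X :: "'x measure" and \<Omega> :: "'a measure" and W :: "('o, 'w) concrete_functor"
  assumes \<alpha>: "\<And>a f. a \<in> Obj W \<Longrightarrow> f \<in> meas_hom \<Omega> (Und W a) \<Longrightarrow> \<alpha> a f \<in> meas_hom X (Und W a)"
    and nat: "\<And>a b h f. a \<in> Obj W \<Longrightarrow> b \<in> Obj W \<Longrightarrow> h \<in> Arr W a b \<Longrightarrow>
        f \<in> meas_hom \<Omega> (Und W a) \<Longrightarrow>
        \<alpha> b (compose (space \<Omega>) h f) = compose (space X) h (\<alpha> a f)"
    and W: "\<And>a b h. a \<in> Obj W \<Longrightarrow> b \<in> Obj W \<Longrightarrow> h \<in> Arr W a b \<Longrightarrow> h \<in> Und W a \<rightarrow>\<^sub>M Und W b"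
  shows "\<exists>!\<tau>. \<tau> \<in> meas_hom X (codensity W \<Omega>) \<and>
    (\<forall>a\<in>Obj W. \<forall>f\<in>meas_hom \<Omega> (Und W a). compose (space X) (codensity_ev W \<Omega> a f) \<tau> = \<alpha> a f)"
proof (rule ex1I)
  let ?\<tau> = "\<lambda>x\<in>space X. \<lambda>(a, f)\<in>codensity_index W \<Omega>. \<alpha> a f x"
  have \<tau>: "?\<tau> \<in> meas_hom X (codensity W \<Omega>)"
  proof (rule codensity_factor[OF _ _ W])
    fix a f assume a: "a \<in> Obj W" and f: "f \<in> meas_hom \<Omega> (Und W a)"
    show "\<alpha> a f \<in> X \<rightarrow>\<^sub>M Und W a" by (rule meas_hom_measurable[OF \<alpha>[OF a f]])
    fix b h x assume "b \<in> Obj W" "h \<in> Arr W a b" "x \<in> space X"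
    with nat[OF a _ _ f] show "\<alpha> b (compose (space \<Omega>) h f) x = h (\<alpha> a f x)"
      by (simp add: compose_def)
  qed
  have "compose (space X) (codensity_ev W \<Omega> a f) ?\<tau> = \<alpha> a f"
    if "a \<in> Obj W" "f \<in> meas_hom \<Omega> (Und W a)" for a f
    using that meas_hom_space[OF \<tau>]
    by (intro meas_hom_eqI[OF meas_hom_compose[OF \<tau>] \<alpha>] meas_hom_measurable[OF codensity_ev_hom])
       (auto simp: compose_def codensity_ev_def codensity_index_def)
  with \<tau> show "?\<tau> \<in> meas_hom X (codensity W \<Omega>) \<and>
    (\<forall>a\<in>Obj W. \<forall>f\<in>meas_hom \<Omega> (Und W a). compose (space X) (codensity_ev W \<Omega> a f) ?\<tau> = \<alpha> a f)"
    by blast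
  fix \<sigma> assume \<sigma>: "\<sigma> \<in> meas_hom X (codensity W \<Omega>) \<and>
    (\<forall>a\<in>Obj W. \<forall>f\<in>meas_hom \<Omega> (Und W a). compose (space X) (codensity_ev W \<Omega> a f) \<sigma> = \<alpha> a f)"
  show "\<sigma> = ?\<tau>"
  proof (rule meas_hom_eqI[OF conjunct1[OF \<sigma>] \<tau>])
    fix x assume x: "x \<in> space X"
    then have sx: "\<sigma> x \<in> space (codensity W \<Omega>)" using \<sigma> by (auto intro: meas_hom_space)
    have "\<sigma> x (a, f) = \<alpha> a f x" if "a \<in> Obj W" "f \<in> meas_hom \<Omega> (Und W a)" for a f
    proof -
      have "compose (space X) (codensity_ev W \<Omega> a f) \<sigma> x = \<alpha> a f x" using \<sigma> that by simp
      then show ?thesis using x sx by (simp add: compose_def codensity_ev_def)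
    qed
    moreover have "\<sigma> x \<in> extensional (codensity_index W \<Omega>)" using sx space_codensity by blast
    ultimately show "\<sigma> x = ?\<tau> x"
      using x by (auto simp: fun_eq_iff codensity_index_def extensional_def)
  qed
qed

lemma codensity_map_hom:
  assumes W: "\<And>a b h. a \<in> Obj W \<Longrightarrow> b \<in> Obj W \<Longrightarrow> h \<in> Arr W a b \<Longrightarrow> h \<in> Und W a \<rightarrow>\<^sub>M Und W b"
    and g: "g \<in> meas_hom \<Omega> \<Omega>'"
  shows "codensity_map W \<Omega> \<Omega>' g \<in> meas_hom (codensity W \<Omega>) (codensity W \<Omega>')"
  unfolding codensity_map_def
proof (rule codensity_factor[OF _ _ W])
  fix a f assume a: "a \<in> Obj W" and f: "f \<in> meas_hom \<Omega>' (Und W a)"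
  have "compose (space \<Omega>) f g \<in> meas_hom \<Omega> (Und W a)"
    by (rule meas_hom_compose[OF g meas_hom_measurable[OF f]])
  from meas_hom_measurable[OF codensity_ev_hom[OF a this]]
  show "(\<lambda>t. t (a, compose (space \<Omega>) f g)) \<in> codensity W \<Omega> \<rightarrow>\<^sub>M Und W a"
    by (simp add: codensity_ev_def cong: measurable_cong)
  fix b h t assume b: "b \<in> Obj W" and h: "h \<in> Arr W a b" and t: "t \<in> space (codensity W \<Omega>)"
  have "compose (space \<Omega>) (compose (space \<Omega>') h f) g = compose (space \<Omega>) h (compose (space \<Omega>) f g)"
    using meas_hom_space[OF g] by (auto simp: compose_def)
  then show "t (b, compose (space \<Omega>) (compose (space \<Omega>') h f) g) = h (t (a, compose (space \<Omega>) f g))"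
    using t a b h \<open>compose (space \<Omega>) f g \<in> _\<close> by (simp add: space_codensity)
qed

definition meas_functor ::
    "('x measure \<Rightarrow> 'y measure) \<Rightarrow> ('x measure \<Rightarrow> 'x measure \<Rightarrow> ('x \<Rightarrow> 'x) \<Rightarrow> 'y \<Rightarrow> 'y) \<Rightarrow> bool" where
  "meas_functor H Hm \<longleftrightarrow>
     (\<forall>M N. \<forall>g\<in>meas_hom M N. Hm M N g \<in> meas_hom (H M) (H N)) \<and>
     (\<forall>M. Hm M M (\<lambda>x\<in>space M. x) = (\<lambda>y\<in>space (H M). y)) \<and>
     (\<forall>L M N. \<forall>f\<in>meas_hom L M. \<forall>g\<in>meas_hom M N.
        Hm L N (compose (space L) g f) = compose (space (H L)) (Hm M N g) (Hm L M f))"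

text \<open>
  \<open>(codensity W, codensity_counit W)\<close> is the right Kan extension of \<open>W\<close> along itself. Since HOL
  cannot quantify over polymorphic functors, \<open>Meas\<close> is here the category of measurable spaces
  over the type in which \<open>W\<close> takes its values.
\<close>

lemma codensity_right_Kan:
  fixes W :: "('o, 'w) concrete_functor" and H :: "'w measure \<Rightarrow> 'y measure"
  assumes W: "\<And>a b h. a \<in> Obj W \<Longrightarrow> b \<in> Obj W \<Longrightarrow> h \<in> Arr W a b \<Longrightarrow> h \<in> Und W a \<rightarrow>\<^sub>M Und W b"
    and H: "meas_functor H Hm"
    and lam: "\<And>a. a \<in> Obj W \<Longrightarrow> l a \<in> meas_hom (H (Und W a)) (Und W a)"
    and lam_nat: "\<And>a b h. a \<in> Obj W \<Longrightarrow> b \<in> Obj W \<Longrightarrow> h \<in> Arr W a b \<Longrightarrow>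
      compose (space (H (Und W a))) (l b) (Hm (Und W a) (Und W b) (\<lambda>x\<in>space (Und W a). h x)) =
      compose (space (H (Und W a))) h (l a)"
  shows "\<exists>!\<tau>. (\<forall>M. \<tau> M \<in> meas_hom (H M) (codensity W M)) \<and>
    (\<forall>M N. \<forall>g\<in>meas_hom M N.
       compose (space (H M)) (\<tau> N) (Hm M N g) = compose (space (H M)) (codensity_map W M N g) (\<tau> M)) \<and>
    (\<forall>a\<in>Obj W. compose (space (H (Und W a))) (codensity_counit W a) (\<tau> (Und W a)) = l a)"
    (is "\<exists>!\<tau>. ?hom \<tau> \<and> ?nat \<tau> \<and> ?fac \<tau>")
proof (rule ex1I)
  have Hhom: "Hm M N g \<in> meas_hom (H M) (H N)" if "g \<in> meas_hom M N" for M N g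
    using H that by (auto simp: meas_functor_def)
  have Hid: "Hm M M (\<lambda>x\<in>space M. x) = (\<lambda>y\<in>space (H M). y)" for M
    using H by (auto simp: meas_functor_def)
  have Hcomp: "Hm L N (compose (space L) g f) y = Hm M N g (Hm L M f y)"
    if "f \<in> meas_hom L M" "g \<in> meas_hom M N" "y \<in> space (H L)" for L M N f g y
    using H that by (auto simp: meas_functor_def compose_def)
  define \<tau> where "\<tau> = (\<lambda>M. \<lambda>y\<in>space (H M). \<lambda>(a, f)\<in>codensity_index W M. l a (Hm M (Und W a) f y))"
  have hom: "\<tau> M \<in> meas_hom (H M) (codensity W M)" for M
    unfolding \<tau>_def
  proof (rule codensity_factor[OF _ _ W])
    fix a f assume a: "a \<in> Obj W" and f: "f \<in> meas_hom M (Und W a)"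
    show "(\<lambda>y. l a (Hm M (Und W a) f y)) \<in> H M \<rightarrow>\<^sub>M Und W a"
      by (rule measurable_compose[OF meas_hom_measurable[OF Hhom[OF f]] meas_hom_measurable[OF lam[OF a]]])
    fix b h y assume b: "b \<in> Obj W" and h: "h \<in> Arr W a b" and y: "y \<in> space (H M)"
    have "compose (space M) h f = compose (space M) (\<lambda>x\<in>space (Und W a). h x) f"
      using meas_hom_space[OF f] by (auto simp: compose_def)
    then have "Hm M (Und W b) (compose (space M) h f) y =
        Hm (Und W a) (Und W b) (\<lambda>x\<in>space (Und W a). h x) (Hm M (Und W a) f y)"
      using Hcomp[OF f meas_hom_restrict[OF W[OF a b h]] y] by simp
    then show "l b (Hm M (Und W b) (compose (space M) h f) y) = h (l a (Hm M (Und W a) f y))"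
      using fun_cong[OF lam_nat[OF a b h], of "Hm M (Und W a) f y"] meas_hom_space[OF Hhom[OF f] y]
      by (simp add: compose_def)
  qed
  have nat: "compose (space (H M)) (\<tau> N) (Hm M N g) = compose (space (H M)) (codensity_map W M N g) (\<tau> M)"
    if g: "g \<in> meas_hom M N" for M N g
  proof (rule meas_hom_eqI)
    show "compose (space (H M)) (\<tau> N) (Hm M N g) \<in> meas_hom (H M) (codensity W N)"
      by (rule meas_hom_compose[OF Hhom[OF g] meas_hom_measurable[OF hom]])
    show "compose (space (H M)) (codensity_map W M N g) (\<tau> M) \<in> meas_hom (H M) (codensity W N)"
      by (rule meas_hom_compose[OF hom meas_hom_measurable[OF codensity_map_hom[OF W g]]])
    fix y assume y: "y \<in> space (H M)"
    have 1: "Hm M N g y \<in> space (H N)" by (rule meas_hom_space[OF Hhom[OF g] y])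
    have 2: "\<tau> M y \<in> space (codensity W M)" by (rule meas_hom_space[OF hom y])
    have 3: "\<tau> M y (a, compose (space M) f g) = l a (Hm N (Und W a) f (Hm M N g y))"
      if "a \<in> Obj W" "f \<in> meas_hom N (Und W a)" for a f
      using y that meas_hom_compose[OF g meas_hom_measurable[OF that(2)]]
      by (simp add: \<tau>_def codensity_index_def Hcomp[OF g that(2) y])
    have "\<tau> N (Hm M N g y) =
        (\<lambda>(a, f)\<in>codensity_index W N. l a (Hm N (Und W a) f (Hm M N g y)))"
      using 1 by (simp add: \<tau>_def)
    also have "\<dots> = (\<lambda>(a, f)\<in>codensity_index W N. \<tau> M y (a, compose (space M) f g))"
      by (rule restrict_ext) (auto simp: codensity_index_def 3)
    also have "\<dots> = codensity_map W M N g (\<tau> M y)"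
      using 2 by (simp add: codensity_map_def)
    finally show "compose (space (H M)) (\<tau> N) (Hm M N g) y =
        compose (space (H M)) (codensity_map W M N g) (\<tau> M) y"
      using y by (simp add: compose_def)
  qed
  have fac: "compose (space (H (Und W a))) (codensity_counit W a) (\<tau> (Und W a)) = l a"
    if a: "a \<in> Obj W" for a
  proof (rule meas_hom_eqI[OF _ lam[OF a]])
    show "compose (space (H (Und W a))) (codensity_counit W a) (\<tau> (Und W a)) \<in>
        meas_hom (H (Und W a)) (Und W a)"
      unfolding codensity_counit_def
      by (rule meas_hom_compose[OF hom meas_hom_measurable[OF codensity_ev_hom[OF a meas_hom_id]]])
    fix y assume y: "y \<in> space (H (Und W a))"
    show "compose (space (H (Und W a))) (codensity_counit W a) (\<tau> (Und W a)) y = l a y"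
      using y a meas_hom_space[OF hom y] meas_hom_id[of "Und W a"]
      by (simp add: compose_def codensity_counit_def codensity_ev_def)
         (simp add: \<tau>_def codensity_index_def Hid)
  qed
  show "?hom \<tau> \<and> ?nat \<tau> \<and> ?fac \<tau>" using hom nat fac by blast
  fix \<sigma> assume \<sigma>: "?hom \<sigma> \<and> ?nat \<sigma> \<and> ?fac \<sigma>"
  show "\<sigma> = \<tau>"
  proof
    fix M show "\<sigma> M = \<tau> M"
    proof (rule meas_hom_eqI[OF _ hom])
      show "\<sigma> M \<in> meas_hom (H M) (codensity W M)" using \<sigma> by blast
      fix y assume y: "y \<in> space (H M)"
      have sp: "\<sigma> M y \<in> space (codensity W M)" using \<sigma> y by (auto intro: meas_hom_space)
      have "\<sigma> M y (a, f) = l a (Hm M (Und W a) f y)"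
        if a: "a \<in> Obj W" and f: "f \<in> meas_hom M (Und W a)" for a f
      proof -
        let ?N = "Und W a"
        let ?z = "Hm M ?N f y"
        have z: "?z \<in> space (H ?N)" by (rule meas_hom_space[OF Hhom[OF f] y])
        have sz: "\<sigma> ?N ?z \<in> space (codensity W ?N)" using \<sigma> z by (auto intro: meas_hom_space)
        have ff: "compose (space M) (\<lambda>x\<in>space ?N. x) f = f"
          using f meas_hom_space[OF f] by (auto simp: compose_def meas_hom_def extensional_def)
        have "compose (space (H M)) (\<sigma> ?N) (Hm M ?N f) y =
            compose (space (H M)) (codensity_map W M ?N f) (\<sigma> M) y"
          using \<sigma> f by simp
        then have "\<sigma> ?N ?z = codensity_map W M ?N f (\<sigma> M y)"
          using y by (simp add: compose_def)
        then have "\<sigma> ?N ?z (a, \<lambda>x\<in>space ?N. x) = \<sigma> M y (a, f)"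
          using sp a meas_hom_id[of ?N] ff by (simp add: codensity_map_def codensity_index_def)
        moreover have "compose (space (H ?N)) (codensity_counit W a) (\<sigma> ?N) ?z = l a ?z"
          using \<sigma> a by simp
        ultimately show ?thesis
          using z sz by (simp add: compose_def codensity_counit_def codensity_ev_def)
      qed
      moreover have "\<sigma> M y \<in> extensional (codensity_index W M)" using sp space_codensity by blast
      ultimately show "\<sigma> M y = \<tau> M y"
        using y by (auto simp: fun_eq_iff codensity_index_def extensional_def \<tau>_def)
    qed
  qed
qed

lemma codensity_unit_hom:
  assumes "\<And>a b h. a \<in> Obj W \<Longrightarrow> b \<in> Obj W \<Longrightarrow> h \<in> Arr W a b \<Longrightarrow> h \<in> Und W a \<rightarrow>\<^sub>M Und W b"
  shows "codensity_unit W \<Omega> \<in> meas_hom \<Omega> (codensity W \<Omega>)"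
  unfolding codensity_unit_def
  by (rule codensity_factor[OF _ _ assms]) (auto simp: compose_def intro: meas_hom_measurable)

lemma codensity_mult_hom:
  assumes "\<And>a b h. a \<in> Obj W \<Longrightarrow> b \<in> Obj W \<Longrightarrow> h \<in> Arr W a b \<Longrightarrow> h \<in> Und W a \<rightarrow>\<^sub>M Und W b"
  shows "codensity_mult W \<Omega> \<in> meas_hom (codensity W (codensity W \<Omega>)) (codensity W \<Omega>)"
  unfolding codensity_mult_def
proof (rule codensity_factor[OF _ _ assms])
  fix a f assume a: "a \<in> Obj W" and f: "f \<in> meas_hom \<Omega> (Und W a)"
  note ev = codensity_ev_hom[OF a f]
  from meas_hom_measurable[OF codensity_ev_hom[OF a ev]]
  show "(\<lambda>\<rho>. \<rho> (a, codensity_ev W \<Omega> a f)) \<in> codensity W (codensity W \<Omega>) \<rightarrow>\<^sub>M Und W a"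
    by (simp add: codensity_ev_def[of W "codensity W \<Omega>"] cong: measurable_cong)
  fix b h \<rho> assume b: "b \<in> Obj W" and h: "h \<in> Arr W a b"
    and "\<rho> \<in> space (codensity W (codensity W \<Omega>))"
  then have "\<rho> (b, compose (space (codensity W \<Omega>)) h (codensity_ev W \<Omega> a f)) =
      h (\<rho> (a, codensity_ev W \<Omega> a f))"
    using a ev unfolding space_codensity[of \<rho>] by blast
  then show "\<rho> (b, codensity_ev W \<Omega> b (compose (space \<Omega>) h f)) = h (\<rho> (a, codensity_ev W \<Omega> a f))"
    by (simp only: codensity_ev_dinatural[OF a b h f])
qed

text \<open>
  The equations \<open>\<kappa> \<circ> \<eta>W = id\<close> and \<open>\<kappa> \<circ> \<mu>W = \<kappa> \<circ> T\<kappa>\<close> determining unit and multiplication. They are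
  stated elementwise; the iterated functor lives over a larger type.
\<close>

lemma codensity_counit_unit:
  assumes "\<And>a b h. a \<in> Obj W \<Longrightarrow> b \<in> Obj W \<Longrightarrow> h \<in> Arr W a b \<Longrightarrow> h \<in> Und W a \<rightarrow>\<^sub>M Und W b"
    and "a \<in> Obj W" "\<omega> \<in> space (Und W a)"
  shows "codensity_counit W a (codensity_unit W (Und W a) \<omega>) = \<omega>"
proof -
  have "codensity_counit W a (codensity_unit W (Und W a) \<omega>) =
      codensity_unit W (Und W a) \<omega> (a, \<lambda>x\<in>space (Und W a). x)"
    unfolding codensity_counit_def codensity_ev_def
    by (rule restrict_apply') (rule meas_hom_space[OF codensity_unit_hom[OF assms(1)] assms(3)])
  also have "\<dots> = \<omega>"
    using assms(2,3) meas_hom_id[of "Und W a"] by (simp add: codensity_unit_def codensity_index_def)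
  finally show ?thesis .
qed

lemma codensity_counit_mult:
  assumes W: "\<And>a b h. a \<in> Obj W \<Longrightarrow> b \<in> Obj W \<Longrightarrow> h \<in> Arr W a b \<Longrightarrow> h \<in> Und W a \<rightarrow>\<^sub>M Und W b"
    and a: "a \<in> Obj W" and \<rho>: "\<rho> \<in> space (codensity W (codensity W (Und W a)))"
  shows "codensity_counit W a (codensity_mult W (Und W a) \<rho>) =
    codensity_counit W a (codensity_map W (codensity W (Und W a)) (Und W a) (codensity_counit W a) \<rho>)"
proof -
  let ?T = "codensity W (Und W a)"
  have k: "codensity_counit W a \<in> meas_hom ?T (Und W a)"
    unfolding codensity_counit_def by (rule codensity_ev_hom[OF a meas_hom_id])
  have id: "compose (space ?T) (\<lambda>x\<in>space (Und W a). x) (codensity_counit W a) = codensity_counit W a"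
    using k meas_hom_space[OF k] by (auto simp: compose_def meas_hom_def extensional_def)
  have ix: "(a, \<lambda>x\<in>space (Und W a). x) \<in> codensity_index W (Und W a)"
    using a meas_hom_id[of "Und W a"] by (simp add: codensity_index_def)
  have "codensity_counit W a (codensity_mult W (Und W a) \<rho>) =
      codensity_mult W (Und W a) \<rho> (a, \<lambda>x\<in>space (Und W a). x)"
    unfolding codensity_counit_def codensity_ev_def
    by (rule restrict_apply') (rule meas_hom_space[OF codensity_mult_hom[OF W] \<rho>])
  also have "\<dots> = \<rho> (a, codensity_counit W a)"
    using \<rho> ix by (simp add: codensity_mult_def codensity_counit_def)
  also have "\<dots> = codensity_map W ?T (Und W a) (codensity_counit W a) \<rho> (a, \<lambda>x\<in>space (Und W a). x)"
    using \<rho> ix id by (simp add: codensity_map_def)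
  also have "\<dots> = codensity_counit W a (codensity_map W ?T (Und W a) (codensity_counit W a) \<rho>)"
    unfolding codensity_counit_def[of W a] codensity_ev_def[of W "Und W a"]
    by (rule restrict_apply'[symmetric])
       (rule meas_hom_space[OF codensity_map_hom[OF W] \<rho>],
        use k in \<open>simp_all add: codensity_counit_def codensity_ev_def\<close>)
  finally show ?thesis .
qed


section \<open>The forgetful functors\<close>

abbreviation unit_interval :: "real measure" where
  "unit_interval \<equiv> restrict_space borel {0..1}"

datatype cobj = Cube nat | Null_seqs

text \<open>
  A point of \<open>I\<^sup>n\<close> is a function \<open>nat \<Rightarrow> real\<close> with value \<open>undefined\<close> at all \<open>i \<ge> n\<close>, as usual for
  \<^const>\<open>PiM\<close>. A convex combination of two such functions, taken at every \<open>i\<close>, again has value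
  \<open>undefined\<close> at \<open>i \<ge> n\<close>; so \<open>affine_maps\<close> need not distinguish cases.
\<close>

fun cobj_space :: "cobj \<Rightarrow> (nat \<Rightarrow> real) measure" where
  "cobj_space (Cube n) = (\<Pi>\<^sub>M i\<in>{..<n}. unit_interval)"
| "cobj_space Null_seqs = restrict_space (\<Pi>\<^sub>M i\<in>UNIV. unit_interval) {x. x \<longlonglongrightarrow> 0}"

definition affine_maps :: "cobj \<Rightarrow> cobj \<Rightarrow> ((nat \<Rightarrow> real) \<Rightarrow> (nat \<Rightarrow> real)) set" where
  "affine_maps a b =
     {h \<in> space (cobj_space a) \<rightarrow> space (cobj_space b).
        \<forall>x\<in>space (cobj_space a). \<forall>y\<in>space (cobj_space a). \<forall>r\<in>{0..1}.
          h (\<lambda>i. r * x i + (1 - r) * y i) = (\<lambda>i. r * h x i + (1 - r) * h y i)}"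

definition functor_U :: "(cobj, nat \<Rightarrow> real) concrete_functor" where
  "functor_U = \<lparr>Obj = range Cube, Arr = affine_maps, Und = cobj_space\<rparr>"

definition functor_V :: "(cobj, nat \<Rightarrow> real) concrete_functor" where
  "functor_V = \<lparr>Obj = insert Null_seqs (range Cube), Arr = affine_maps, Und = cobj_space\<rparr>"

lemma cobj_space_convex:
  assumes "x \<in> space (cobj_space a)" "y \<in> space (cobj_space a)" "r \<in> {0..1}"
  shows "(\<lambda>i. r * x i + (1 - r) * y i) \<in> space (cobj_space a)"
proof -
  have c: "0 \<le> r * u + (1 - r) * v \<and> r * u + (1 - r) * v \<le> 1"
    if "0 \<le> u \<and> u \<le> 1" "0 \<le> v \<and> v \<le> 1" for u v :: real
    using that assms(3) convex_bound_le[of u 1 v r "1 - r"] by simp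
  show ?thesis
  proof (cases a)
    case (Cube n)
    have "r * x i + (1 - r) * y i = undefined" if "i \<notin> {..<n}" for i
    proof -
      have "x i = undefined" "y i = undefined"
        using assms(1,2) Cube that by (simp_all add: space_PiM PiE_iff extensional_def)
      then show ?thesis by (simp add: algebra_simps)
    qed
    moreover have "0 \<le> x i \<and> x i \<le> 1" "0 \<le> y i \<and> y i \<le> 1" if "i < n" for i
      using assms(1,2) Cube that by (simp_all add: space_PiM PiE_iff)
    ultimately show ?thesis
      unfolding Cube using c by (simp add: space_PiM PiE_iff extensional_def)
  next
    case Null_seqs
    then have lim: "x \<longlonglongrightarrow> 0" "y \<longlonglongrightarrow> 0" and "\<forall>i. 0 \<le> x i \<and> x i \<le> 1" "\<forall>i. 0 \<le> y i \<and> y i \<le> 1"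
      using assms(1,2) by (simp_all add: space_restrict_space space_PiM PiE_iff)
    moreover have "(\<lambda>i. r * x i + (1 - r) * y i) \<longlonglongrightarrow> 0"
      using tendsto_add[OF tendsto_mult_left[OF lim(1), of r] tendsto_mult_left[OF lim(2), of "1 - r"]]
      by simp
    ultimately show ?thesis
      unfolding Null_seqs using c by (simp add: space_restrict_space space_PiM PiE_iff)
  qed
qed

text \<open>Morphisms are measurable, so the universal properties above apply to both functors.\<close>

lemma affine_functional_measurable:
  fixes g :: "(nat \<Rightarrow> real) \<Rightarrow> real"
  assumes g01: "\<And>x. x \<in> space (cobj_space a) \<Longrightarrow> 0 \<le> g x \<and> g x \<le> 1"
    and aff: "\<And>x y r. x \<in> space (cobj_space a) \<Longrightarrow> y \<in> space (cobj_space a) \<Longrightarrow> r \<in> {0..1} \<Longrightarrow>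
      g (\<lambda>i. r * x i + (1 - r) * y i) = r * g x + (1 - r) * g y"
  shows "g \<in> borel_measurable (cobj_space a)"
proof -
  let ?S = "space (cobj_space a)"
  define D where "D = (case a of Cube n \<Rightarrow> {..<n} | Null_seqs \<Rightarrow> UNIV)"
  have S: "x \<in> ?S \<longleftrightarrow> (\<forall>i\<in>D. 0 \<le> x i \<and> x i \<le> 1) \<and> (\<forall>i. i \<notin> D \<longrightarrow> x i = undefined) \<and>
      (a = Null_seqs \<longrightarrow> x \<longlonglongrightarrow> 0)" for x
    by (cases a) (auto simp: D_def space_PiM space_restrict_space PiE_iff extensional_def)
  have meas: "(\<lambda>x. x i) \<in> borel_measurable (cobj_space a)" if "i \<in> D" for i
  proof (cases a)
    case (Cube n)
    with that show ?thesis
      using measurable_component_singleton[of i "{..<n}" "\<lambda>_. unit_interval"]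
      by (auto simp: D_def measurable_restrict_space2_iff)
  next
    case Null_seqs
    then show ?thesis
      using measurable_component_singleton[of i UNIV "\<lambda>_. unit_interval"]
      by (auto simp: measurable_restrict_space2_iff intro!: measurable_restrict_space1)
  qed
  have fin_lim: "x \<longlonglongrightarrow> 0" if "\<And>i. i \<ge> k \<Longrightarrow> x i = 0" for x :: "nat \<Rightarrow> real" and k
    by (rule tendsto_eventually) (use that in \<open>auto simp: eventually_at_top_linorder\<close>)
  define z where "z = (\<lambda>i. if i \<in> D then 0 else undefined :: real)"
  define e where "e k = (\<lambda>i. if i \<in> D then (if i = k then 1 else 0) else undefined :: real)" for k
  define p where "p k x = (\<lambda>i. if i \<in> D then (if i < k then x i else 0) else undefined :: real)" for k x
  have z: "z \<in> ?S" by (auto simp: S z_def D_def intro!: fin_lim[of 0])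
  have e: "e k \<in> ?S" for k by (auto simp: S e_def D_def intro!: fin_lim[of "Suc k"])
  have p: "p k x \<in> ?S" if "x \<in> ?S" for k x
    using that by (auto simp: S p_def D_def intro!: fin_lim[of k])
  have scale: "g (\<lambda>i. r * x i + (1 - r) * z i) = r * g x + (1 - r) * g z"
    if "x \<in> ?S" "r \<in> {0..1}" for x r
    using aff[OF that(1) z that(2)] .
  have add: "g w + g z = g u + g v"
    if "u \<in> ?S" "v \<in> ?S" "w \<in> ?S" "\<And>i. i \<in> D \<Longrightarrow> w i = u i + v i" for u v w
  proof -
    have "(\<lambda>i. 1/2 * w i + (1 - 1/2) * z i) = (\<lambda>i. 1/2 * u i + (1 - 1/2) * v i)"
    proof
      fix i show "1/2 * w i + (1 - 1/2) * z i = 1/2 * u i + (1 - 1/2) * v i"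
        using that by (cases "i \<in> D") (auto simp: z_def S)
    qed
    then show ?thesis using aff[OF that(3) z, of "1/2"] aff[OF that(1,2), of "1/2"] by simp
  qed
  have pSuc: "g (p (Suc k) x) = g (p k x) + (if k \<in> D then x k * (g (e k) - g z) else 0)"
    if x: "x \<in> ?S" for k x
  proof (cases "k \<in> D")
    case True
    let ?v = "\<lambda>i. x k * e k i + (1 - x k) * z i"
    have r: "x k \<in> {0..1}" using x True by (simp add: S)
    have "g (p (Suc k) x) + g z = g (p k x) + g ?v"
      by (rule add[OF p[OF x] cobj_space_convex[OF e z r] p[OF x]])
         (auto simp: p_def e_def z_def less_Suc_eq)
    then show ?thesis using scale[OF e[of k] r] True by (simp add: algebra_simps)
  next
    case False
    then have "p (Suc k) x = p k x" by (auto simp: p_def fun_eq_iff less_Suc_eq)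
    with False show ?thesis by simp
  qed
  have g_p: "g (p k x) = g z + (\<Sum>i<k. if i \<in> D then x i * (g (e i) - g z) else 0)"
    if "x \<in> ?S" for k x
  proof (induction k)
    case 0
    have "p 0 x = z" by (simp add: p_def z_def fun_eq_iff)
    then show ?case by simp
  qed (simp add: pSuc[OF that])
  have summand: "(\<lambda>x. if i \<in> D then x i * (g (e i) - g z) else 0) \<in> borel_measurable (cobj_space a)" for i
    by (cases "i \<in> D") (auto intro!: borel_measurable_times meas)
  have p_meas: "(\<lambda>x. g (p k x)) \<in> borel_measurable (cobj_space a)" for k
  proof -
    have "(\<lambda>x. g z + (\<Sum>i<k. if i \<in> D then x i * (g (e i) - g z) else 0))
        \<in> borel_measurable (cobj_space a)"
      by (intro borel_measurable_add borel_measurable_sum borel_measurable_const summand)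
    then show ?thesis by (simp add: g_p cong: measurable_cong)
  qed
  have lim: "(\<lambda>k. g (p k x)) \<longlonglongrightarrow> g x" if x: "x \<in> ?S" for x
  proof (cases a)
    case (Cube n)
    have "p k x = x" if "k \<ge> n" for k
      using x[unfolded S] that Cube by (auto simp: p_def D_def fun_eq_iff)
    then show ?thesis
      by (intro tendsto_eventually) (auto simp: eventually_at_top_linorder intro!: exI[of _ n])
  next
    case Null_seqs
    then have D: "D = UNIV" by (simp add: D_def)
    have x0: "x \<longlonglongrightarrow> 0" and x01: "\<And>i. 0 \<le> x i \<and> x i \<le> 1" using x[unfolded S] Null_seqs D by auto
    show ?thesis
    proof (rule LIMSEQ_I)
      fix \<epsilon> :: real assume "0 < \<epsilon>"
      define d where "d = min (\<epsilon> / 2) 1"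
      have d: "0 < d" "d \<le> 1" "d < \<epsilon>" using \<open>0 < \<epsilon>\<close> by (auto simp: d_def min_def)
      obtain N where N: "\<And>i. i \<ge> N \<Longrightarrow> x i < d"
        using LIMSEQ_D[OF x0 d(1)] by (auto dest: abs_less_iff[THEN iffD1])
      have "norm (g (p k x) - g x) < \<epsilon>" if "k \<ge> N" for k
      proof -
        define y where "y = (\<lambda>i. if i < k then 0 else x i / d)"
        have "(\<lambda>i. x i / d) \<longlonglongrightarrow> 0" using tendsto_divide[OF x0 tendsto_const[of d]] d by simp
        moreover have "eventually (\<lambda>i. x i / d = y i) sequentially"
          unfolding eventually_at_top_linorder by (rule exI[of _ k]) (simp add: y_def)
        ultimately have y0: "y \<longlonglongrightarrow> 0" by (rule Lim_transform_eventually)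
        have y: "y \<in> ?S"
          unfolding S using x01 d N that y0 by (auto simp: D y_def field_simps intro: less_imp_le)
        have r: "d \<in> {0..1}" using d by simp
        have "g x + g z = g (p k x) + g (\<lambda>i. d * y i + (1 - d) * z i)"
          by (rule add[OF p[OF x] cobj_space_convex[OF y z r] x])
             (use d in \<open>auto simp: p_def y_def z_def\<close>)
        then have "g (p k x) - g x = d * (g z - g y)"
          using scale[OF y r] by (simp add: algebra_simps)
        moreover have 1: "\<bar>g z - g y\<bar> \<le> 1" using g01[OF z] g01[OF y] by linarith
        have "d * \<bar>g z - g y\<bar> < \<epsilon>"
          by (rule le_less_trans[OF mult_left_le[OF 1 less_imp_le[OF d(1)]] d(3)])
        ultimately show ?thesis using d(1) by (simp add: abs_mult)
      qed
      then show "\<exists>N. \<forall>k\<ge>N. norm (g (p k x) - g x) < \<epsilon>" by blast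
    qed
  qed
  show ?thesis by (rule borel_measurable_LIMSEQ_real[OF lim p_meas])
qed

lemma affine_maps_measurable:
  assumes h: "h \<in> affine_maps a b"
  shows "h \<in> cobj_space a \<rightarrow>\<^sub>M cobj_space b"
proof -
  have hS: "h x \<in> space (cobj_space b)" if "x \<in> space (cobj_space a)" for x
    using h that by (auto simp: affine_maps_def)
  have comp: "(\<lambda>x. h x i) \<in> cobj_space a \<rightarrow>\<^sub>M unit_interval"
    if i: "\<And>y. y \<in> space (cobj_space b) \<Longrightarrow> y i \<in> {0..1}" for i
  proof (rule measurable_restrict_space2)
    show "(\<lambda>x. h x i) \<in> space (cobj_space a) \<rightarrow> {0..1}" using i hS by blast
    show "(\<lambda>x. h x i) \<in> borel_measurable (cobj_space a)"
      by (rule affine_functional_measurable) (use i hS h in \<open>auto simp: affine_maps_def\<close>)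
  qed
  show ?thesis
  proof (cases b)
    case (Cube n)
    have "h \<in> cobj_space a \<rightarrow>\<^sub>M (\<Pi>\<^sub>M i\<in>{..<n}. unit_interval)"
    proof (rule measurable_PiM_single')
      show "(\<lambda>x. h x i) \<in> cobj_space a \<rightarrow>\<^sub>M unit_interval" if "i \<in> {..<n}" for i
        by (rule comp) (use that Cube in \<open>auto simp: space_PiM PiE_iff\<close>)
    qed (use hS Cube in \<open>auto simp: space_PiM\<close>)
    with Cube show ?thesis by simp
  next
    case Null_seqs
    have "h \<in> cobj_space a \<rightarrow>\<^sub>M (\<Pi>\<^sub>M i\<in>UNIV. unit_interval)"
    proof (rule measurable_PiM_single')
      show "(\<lambda>x. h x i) \<in> cobj_space a \<rightarrow>\<^sub>M unit_interval" for i
        by (rule comp) (use Null_seqs in \<open>auto simp: space_restrict_space space_PiM PiE_iff\<close>)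
    qed (use hS Null_seqs in \<open>auto simp: space_restrict_space space_PiM\<close>)
    with Null_seqs hS show ?thesis
      by (auto intro!: measurable_restrict_space2 simp: space_restrict_space)
  qed
qed


lemma forgetful_functors_measurable:
  "h \<in> Arr functor_U a b \<Longrightarrow> h \<in> Und functor_U a \<rightarrow>\<^sub>M Und functor_U b"
  "h \<in> Arr functor_V a b \<Longrightarrow> h \<in> Und functor_V a \<rightarrow>\<^sub>M Und functor_V b"
  by (simp_all add: functor_U_def functor_V_def affine_maps_measurable)


section \<open>The finitely additive Giry monad\<close>

text \<open>Set functions are normalised to \<open>undefined\<close> outside the \<open>\<sigma>\<close>-algebra.\<close>

definition fin_add_probs :: "'a measure \<Rightarrow> ('a set \<Rightarrow> real) set" where
  "fin_add_probs \<Omega> =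
     {\<pi> \<in> sets \<Omega> \<rightarrow>\<^sub>E {0..1}. \<pi> (space \<Omega>) = 1 \<and>
        (\<forall>A\<in>sets \<Omega>. \<forall>B\<in>sets \<Omega>. A \<inter> B = {} \<longrightarrow> \<pi> (A \<union> B) = \<pi> A + \<pi> B)}"

definition fin_add_integral :: "'a measure \<Rightarrow> ('a set \<Rightarrow> real) \<Rightarrow> ('a \<Rightarrow> real) \<Rightarrow> real" where
  "fin_add_integral \<Omega> \<pi> f =
     (SUP s \<in> {s :: 'a \<Rightarrow> real. simple_function \<Omega> s \<and> (\<forall>\<omega>\<in>space \<Omega>. s \<omega> \<le> f \<omega>)}.
        \<Sum>a \<in> s ` space \<Omega>. a * \<pi> (s -` {a} \<inter> space \<Omega>))"

definition fin_giry :: "'a measure \<Rightarrow> ('a set \<Rightarrow> real) measure" where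
  "fin_giry \<Omega> =
     sigma (fin_add_probs \<Omega>) {{\<pi> \<in> fin_add_probs \<Omega>. \<pi> A \<in> B} | A B. A \<in> sets \<Omega> \<and> B \<in> sets borel}"

definition fin_giry_map ::
    "'a measure \<Rightarrow> 'b measure \<Rightarrow> ('a \<Rightarrow> 'b) \<Rightarrow> ('a set \<Rightarrow> real) \<Rightarrow> ('b set \<Rightarrow> real)" where
  "fin_giry_map \<Omega> \<Omega>' g \<pi> = (\<lambda>A\<in>sets \<Omega>'. \<pi> (g -` A \<inter> space \<Omega>))"

definition fin_giry_unit :: "'a measure \<Rightarrow> 'a \<Rightarrow> ('a set \<Rightarrow> real)" where
  "fin_giry_unit \<Omega> \<omega> = (\<lambda>A\<in>sets \<Omega>. indicator A \<omega>)"

definition fin_giry_mult :: "'a measure \<Rightarrow> (('a set \<Rightarrow> real) set \<Rightarrow> real) \<Rightarrow> ('a set \<Rightarrow> real)" where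
  "fin_giry_mult \<Omega> \<rho> = (\<lambda>A\<in>sets \<Omega>. fin_add_integral (fin_giry \<Omega>) \<rho> (\<lambda>\<pi>. \<pi> A))"


section \<open>The Giry monad\<close>

text \<open>
  \<^const>\<open>prob_algebra\<close>, with functorial action \<^const>\<open>distr\<close> and unit \<^const>\<open>return\<close>. The library's
  \<^const>\<open>join\<close> is only meant for \<^const>\<open>subprob_algebra\<close>; binding to the identity is the
  multiplication on \<^const>\<open>prob_algebra\<close>.
\<close>

definition giry_mult :: "'a measure measure \<Rightarrow> 'a measure" where
  "giry_mult \<rho> = \<rho> \<bind> (\<lambda>\<pi>. \<pi>)"

lemma giry_mult_eq:
  assumes "\<rho> \<in> space (prob_algebra (prob_algebra \<Omega>))"
  shows "sets (giry_mult \<rho>) = sets \<Omega>"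
    and "A \<in> sets \<Omega> \<Longrightarrow> emeasure (giry_mult \<rho>) A = (\<integral>\<^sup>+ \<pi>. emeasure \<pi> A \<partial>\<rho>)"
proof -
  have id: "(\<lambda>\<pi>. \<pi>) \<in> prob_algebra \<Omega> \<rightarrow>\<^sub>M prob_algebra \<Omega>" by simp
  show "sets (giry_mult \<rho>) = sets \<Omega>"
    unfolding giry_mult_def by (rule sets_bind'[OF assms id])
  show "A \<in> sets \<Omega> \<Longrightarrow> emeasure (giry_mult \<rho>) A = (\<integral>\<^sup>+ \<pi>. emeasure \<pi> A \<partial>\<rho>)"
    unfolding giry_mult_def by (rule emeasure_bind_prob_algebra[OF assms id])
qed


section \<open>The comparison maps\<close>

text \<open>
  An element \<open>t\<close> of the codensity monad is sent to the set function \<open>A \<mapsto> ev\<^bsub>\<chi>\<^sub>A\<^esub>(t)\<close>, where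
  \<open>\<chi>\<^sub>A : \<Omega> \<rightarrow> I = I\<^sup>1\<close>. HOL cannot quantify existentially over families that are polymorphic in the
  type of \<open>\<Omega>\<close>, so the isomorphisms of monads are given as explicit families.
\<close>

definition char_map :: "'a measure \<Rightarrow> 'a set \<Rightarrow> ('a \<Rightarrow> nat \<Rightarrow> real)" where
  "char_map \<Omega> A = (\<lambda>\<omega>\<in>space \<Omega>. \<lambda>i\<in>{..<1}. indicator A \<omega>)"

definition to_fin_giry ::
    "'a measure \<Rightarrow> (cobj \<times> ('a \<Rightarrow> nat \<Rightarrow> real) \<Rightarrow> nat \<Rightarrow> real) \<Rightarrow> ('a set \<Rightarrow> real)" where
  "to_fin_giry \<Omega> t = (\<lambda>A\<in>sets \<Omega>. t (Cube 1, char_map \<Omega> A) 0)"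

definition to_giry ::
    "'a measure \<Rightarrow> (cobj \<times> ('a \<Rightarrow> nat \<Rightarrow> real) \<Rightarrow> nat \<Rightarrow> real) \<Rightarrow> 'a measure" where
  "to_giry \<Omega> t = measure_of (space \<Omega>) (sets \<Omega>) (\<lambda>A. ennreal (t (Cube 1, char_map \<Omega> A) 0))"

end

theory Submission
  imports Defs
begin

text \<open>
  A point \<open>t\<close> of either codensity monad acts on measurable maps \<open>\<Omega> \<rightarrow> I\<close>. Naturality along the
  projections \<open>I\<^sup>n \<rightarrow> I\<close> and \<open>d\<^sub>0 \<rightarrow> I\<close> shows that this action determines \<open>t\<close>; naturality along
  \<open>x \<mapsto> (x\<^sub>0 + x\<^sub>1) / 2\<close> on \<open>I\<^sup>2\<close>, along scalings and along constants makes it a positive, additive,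
  homogeneous and normalised functional. Such a functional is the integral against its values on
  indicators, because a map into \<open>I\<close> is a uniform limit of averages of indicators of its upper
  level sets. Conversely, every such functional \<open>J\<close> commutes with affine maps \<open>I\<^sup>n \<rightarrow> I\<close>, and with
  affine maps \<open>d\<^sub>0 \<rightarrow> I\<close> as soon as \<open>J f\<^sub>n \<rightarrow> 0\<close> whenever \<open>f\<^sub>n \<rightarrow> 0\<close> pointwise, so that it defines a
  point of the codensity monad. For \<open>d\<^sub>0\<close> the continuity is automatic: if \<open>A\<^sub>i\<close> decreases to the empty
  set, the indicators of the \<open>A\<^sub>i\<close> form a map \<open>\<Omega> \<rightarrow> d\<^sub>0\<close>, and \<open>t\<close> evaluated there is a null sequence.
\<close>

section \<open>Means of functions with values in the unit interval\<close>

text \<open>Maps from \<Omega> to I are kept as real functions with arbitrary values outside the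
  space, not as elements of \<open>meas_hom\<close>, so that they can be added and scaled
  freely.\<close>

definition unit_functions :: "'a measure \<Rightarrow> ('a \<Rightarrow> real) set" where
  "unit_functions \<Omega> = {f \<in> borel_measurable \<Omega>. \<forall>\<omega>\<in>space \<Omega>. 0 \<le> f \<omega> \<and> f \<omega> \<le> 1}"

lemma unit_functionsI:
  "f \<in> borel_measurable \<Omega> \<Longrightarrow> (\<And>\<omega>. \<omega> \<in> space \<Omega> \<Longrightarrow> 0 \<le> f \<omega> \<and> f \<omega> \<le> 1) \<Longrightarrow> f \<in> unit_functions \<Omega>"
  by (simp add: unit_functions_def)

lemma unit_functionsD:
  assumes "f \<in> unit_functions \<Omega>"
  shows "f \<in> borel_measurable \<Omega>" "\<omega> \<in> space \<Omega> \<Longrightarrow> 0 \<le> f \<omega>" "\<omega> \<in> space \<Omega> \<Longrightarrow> f \<omega> \<le> 1"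
  using assms by (auto simp: unit_functions_def)

lemma indicator_unit_function: "A \<in> sets \<Omega> \<Longrightarrow> indicator A \<in> unit_functions \<Omega>"
  by (rule unit_functionsI) (auto simp: indicator_def)

lemma const_unit_function: "c \<in> {0..1} \<Longrightarrow> (\<lambda>_. c) \<in> unit_functions \<Omega>"
  by (rule unit_functionsI) auto

lemma scale_unit_function:
  assumes "f \<in> unit_functions \<Omega>" "c \<in> {0..1}"
  shows "(\<lambda>\<omega>. c * f \<omega>) \<in> unit_functions \<Omega>"
  using assms unit_functionsD[OF assms(1)] by (intro unit_functionsI) (auto intro: mult_le_one)

lemma unit_function_compose:
  assumes "f \<in> unit_functions N" "g \<in> M \<rightarrow>\<^sub>M N"
  shows "(\<lambda>x. f (g x)) \<in> unit_functions M"
  using unit_functionsD[OF assms(1)] measurable_space[OF assms(2)]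
  by (intro unit_functionsI measurable_compose[OF assms(2)]) auto

text \<open>Addition and scaling are partial, since the results must stay in I. The axiom
  \<open>cong\<close> compensates for the arbitrary values of unit functions outside the
  space.\<close>

locale mean =
  fixes \<Omega> :: "'a measure" and I :: "('a \<Rightarrow> real) \<Rightarrow> real"
  assumes cong: "\<lbrakk>f \<in> unit_functions \<Omega>; g \<in> unit_functions \<Omega>; \<And>\<omega>. \<omega> \<in> space \<Omega> \<Longrightarrow> f \<omega> = g \<omega>\<rbrakk> \<Longrightarrow> I f = I g"
    and nonneg: "f \<in> unit_functions \<Omega> \<Longrightarrow> 0 \<le> I f"
    and add: "\<lbrakk>f \<in> unit_functions \<Omega>; g \<in> unit_functions \<Omega>; (\<lambda>\<omega>. f \<omega> + g \<omega>) \<in> unit_functions \<Omega>\<rbrakk> \<Longrightarrow>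
      I (\<lambda>\<omega>. f \<omega> + g \<omega>) = I f + I g"
    and scale: "\<lbrakk>f \<in> unit_functions \<Omega>; c \<in> {0..1}\<rbrakk> \<Longrightarrow> I (\<lambda>\<omega>. c * f \<omega>) = c * I f"
    and one: "I (\<lambda>_. 1) = 1"
begin

lemma mono:
  assumes "f \<in> unit_functions \<Omega>" "g \<in> unit_functions \<Omega>" "\<And>\<omega>. \<omega> \<in> space \<Omega> \<Longrightarrow> f \<omega> \<le> g \<omega>"
  shows "I f \<le> I g"
proof -
  \<comment> \<open>Monotonicity comes from positivity of the difference, which again takes values
    in I.\<close>
  have d: "(\<lambda>\<omega>. g \<omega> - f \<omega>) \<in> unit_functions \<Omega>"
  proof (rule unit_functionsI)
    show "(\<lambda>\<omega>. g \<omega> - f \<omega>) \<in> borel_measurable \<Omega>"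
      using unit_functionsD(1)[OF assms(1)] unit_functionsD(1)[OF assms(2)] by measurable
    show "0 \<le> g \<omega> - f \<omega> \<and> g \<omega> - f \<omega> \<le> 1" if "\<omega> \<in> space \<Omega>" for \<omega>
      using assms(3) unit_functionsD(2)[OF assms(1)] unit_functionsD(3)[OF assms(2)] that
      by (smt (verit))
  qed
  show ?thesis using add[OF assms(1) d] assms(2) nonneg[OF d] by simp
qed

lemma const: "c \<in> {0..1} \<Longrightarrow> I (\<lambda>_. c) = c"
  using scale[OF const_unit_function[of 1], of c] one by simp

lemma le_one: "f \<in> unit_functions \<Omega> \<Longrightarrow> I f \<le> 1"
  using mono[of f "\<lambda>_. 1"] one const_unit_function[of 1 \<Omega>] by (simp add: unit_functionsD(3))

lemma zero: "I (\<lambda>_. 0) = 0"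
  using const[of 0] by simp

lemma diff:
  assumes "f \<in> unit_functions \<Omega>" "g \<in> unit_functions \<Omega>" "(\<lambda>\<omega>. g \<omega> - f \<omega>) \<in> unit_functions \<Omega>"
  shows "I (\<lambda>\<omega>. g \<omega> - f \<omega>) = I g - I f"
  using add[OF assms(1,3)] assms(2) by simp

end

section \<open>Uniform approximation by averages of indicators of level sets\<close>

lemma sum_le_indicator_eq_floor:
  assumes "0 \<le> y" "y \<le> real n"
  shows "(\<Sum>k<n. if real (Suc k) \<le> y then 1 else 0) = real (nat \<lfloor>y\<rfloor>)"
proof -
  \<comment> \<open>The counted indices k are those whose threshold k + 1 is at most y, and
    \<open>y \<le> real n\<close> ensures that all of them lie below n.\<close>
  have "{..<n} \<inter> {k. real (Suc k) \<le> y} = {..<nat \<lfloor>y\<rfloor>}"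
    using assms by (auto simp: le_nat_floor Suc_le_eq[symmetric]) linarith+
  then show ?thesis by (simp add: sum.If_cases)
qed

text \<open>With thresholds (k + 1) / n rather than k / n, the average of the n indicators rounds f
  down to a multiple of 1 / n. The inequality is multiplied by n to match the floor of
  \<open>real n * f \<omega>\<close>.\<close>

definition upper_level :: "'a measure \<Rightarrow> ('a \<Rightarrow> real) \<Rightarrow> nat \<Rightarrow> nat \<Rightarrow> 'a set" where
  "upper_level \<Omega> f n k = {\<omega> \<in> space \<Omega>. real (Suc k) \<le> real n * f \<omega>}"

lemma upper_level_sets: "f \<in> borel_measurable \<Omega> \<Longrightarrow> upper_level \<Omega> f n k \<in> sets \<Omega>"
  unfolding upper_level_def by measurable

context mean
begin

text \<open>The average of the indicators lies below f by at most 1 / n, uniformly, and it is a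
  finite sum. Hence finite additivity, monotonicity and the value on constants suffice for the
  estimate.\<close>

lemma approx_upper_levels:
  assumes f: "f \<in> unit_functions \<Omega>" and n: "0 < n"
  shows "\<bar>(\<Sum>k<n. I (indicator (upper_level \<Omega> f n k))) / n - I f\<bar> \<le> 1 / n"
proof -
  let ?A = "upper_level \<Omega> f n"
  note fD = unit_functionsD[OF f]
  have A: "?A k \<in> sets \<Omega>" for k by (rule upper_level_sets[OF fD(1)])
  \<comment> \<open>Dividing each summand by n keeps every partial sum of at most n terms in I, so
    \<open>add\<close> applies at each step of the induction on m.\<close>
  define s where "s m = (\<lambda>\<omega>. \<Sum>k<m. 1 / real n * indicator (?A k) \<omega> :: real)" for m
  have s_unit: "s m \<in> unit_functions \<Omega>" if "m \<le> n" for m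
  proof (rule unit_functionsI)
    show "s m \<in> borel_measurable \<Omega>" unfolding s_def using A by measurable
    have "s m \<omega> \<le> (\<Sum>k<m. 1 / real n)" for \<omega>
      unfolding s_def using n by (intro sum_mono) (simp add: indicator_def)
    moreover have "(\<Sum>k<m. 1 / real n) \<le> 1" using that n by simp
    ultimately show "0 \<le> s m \<omega> \<and> s m \<omega> \<le> 1" for \<omega>
      by (meson order_trans) (auto simp: s_def intro!: sum_nonneg)
  qed
  have Is: "I (s m) = (\<Sum>k<m. I (indicator (?A k))) / n" if "m \<le> n" for m
    using that
  proof (induction m)
    case 0
    show ?case by (simp add: s_def zero)
  next
    case (Suc m)
    let ?i = "\<lambda>\<omega>. 1 / real n * indicator (?A m) \<omega> :: real"
    have i: "?i \<in> unit_functions \<Omega>"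
      by (rule scale_unit_function[OF indicator_unit_function[OF A]]) (use n in simp)
    have eq: "s (Suc m) = (\<lambda>\<omega>. s m \<omega> + ?i \<omega>)" by (simp add: s_def)
    have "I (s (Suc m)) = I (s m) + I ?i"
      unfolding eq by (rule add[OF s_unit i]) (use Suc s_unit[of "Suc m"] eq in auto)
    also have "I ?i = I (indicator (?A m)) / n"
      using scale[OF indicator_unit_function[OF A], of "1 / real n"] n by simp
    finally show ?case using Suc by (simp add: add_divide_distrib)
  qed
  have s_floor: "s n \<omega> = real (nat \<lfloor>real n * f \<omega>\<rfloor>) / n" if "\<omega> \<in> space \<Omega>" for \<omega>
  proof -
    have "s n \<omega> = (\<Sum>k<n. if real (Suc k) \<le> real n * f \<omega> then 1 else 0) / n"
      unfolding s_def sum_divide_distrib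
      by (rule sum.cong) (use that in \<open>auto simp: upper_level_def\<close>)
    then show ?thesis
      using fD(2,3)[OF that] n by (subst (asm) sum_le_indicator_eq_floor) (auto simp: mult_left_le)
  qed
  have bnd: "s n \<omega> \<le> f \<omega>" "f \<omega> \<le> s n \<omega> + 1 / n" if "\<omega> \<in> space \<Omega>" for \<omega>
  proof -
    have y: "real (nat \<lfloor>real n * f \<omega>\<rfloor>) = of_int \<lfloor>real n * f \<omega>\<rfloor>"
      using fD(2)[OF that] by simp
    show "s n \<omega> \<le> f \<omega>" "f \<omega> \<le> s n \<omega> + 1 / n"
      using n unfolding s_floor[OF that] y
      by (simp_all add: field_simps) linarith+
  qed
  let ?d = "\<lambda>\<omega>. f \<omega> - s n \<omega>"
  have c: "1 / real n \<in> {0..1}" using n by simp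
  have d01: "0 \<le> ?d \<omega> \<and> ?d \<omega> \<le> 1 / n" if "\<omega> \<in> space \<Omega>" for \<omega>
    using bnd[OF that] by simp
  have d: "?d \<in> unit_functions \<Omega>"
    using d01 c fD(1) unit_functionsD(1)[OF s_unit[OF order_refl]]
    by (intro unit_functionsI) (auto intro: order_trans)
  have "I ?d = I f - I (s n)" by (rule diff[OF s_unit f d]) simp
  moreover have "I ?d \<le> 1 / n"
    using mono[OF d const_unit_function[OF c]] d01 const[OF c] by simp
  ultimately show ?thesis using nonneg[OF d] by (simp add: Is)
qed

text \<open>This serves two purposes: uniqueness of a mean with given values on indicators, and
  measurability of means that depend on a parameter.\<close>

lemma LIMSEQ_upper_levels:
  assumes "f \<in> unit_functions \<Omega>"
  shows "(\<lambda>n. (\<Sum>k<n. I (indicator (upper_level \<Omega> f n k))) / n) \<longlonglongrightarrow> I f"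
proof (rule Lim_null[THEN iffD2], rule tendsto_0_le[OF lim_inverse_n, where K = 1])
  show "\<forall>\<^sub>F n in sequentially. norm ((\<Sum>k<n. I (indicator (upper_level \<Omega> f n k))) / n - I f)
      \<le> norm (inverse (real n)) * 1"
    \<comment> \<open>The estimate assumes n positive, hence the restriction to eventually all
      n.\<close>
    using eventually_gt_at_top[of 0]
    by eventually_elim (use approx_upper_levels[OF assms] in \<open>simp add: inverse_eq_divide\<close>)
qed

text \<open>Both means are limits of averages over the same level sets, and these averages involve
  indicators only.\<close>

lemma eqI_indicator:
  assumes "mean \<Omega> J" and "\<And>A. A \<in> sets \<Omega> \<Longrightarrow> I (indicator A) = J (indicator A)"
    and "f \<in> unit_functions \<Omega>"
  shows "I f = J f"
proof (rule LIMSEQ_unique[OF LIMSEQ_upper_levels[OF assms(3)]])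
  show "(\<lambda>n. (\<Sum>k<n. I (indicator (upper_level \<Omega> f n k))) / n) \<longlonglongrightarrow> J f"
    using mean.LIMSEQ_upper_levels[OF assms(1,3)] assms(2)
    by (simp add: upper_level_sets unit_functionsD(1)[OF assms(3)])
qed

lemma indicator_Un:
  assumes "A \<in> sets \<Omega>" "B \<in> sets \<Omega>" "A \<inter> B = {}"
  shows "I (indicator (A \<union> B)) = I (indicator A) + I (indicator B)"
proof -
  have "indicator (A \<union> B) = (\<lambda>\<omega>. indicator A \<omega> + indicator B \<omega> :: real)"
    using assms(3) by (auto simp: indicator_def fun_eq_iff)
  with add[of "indicator A" "indicator B"] show ?thesis
    using indicator_unit_function[of "A \<union> B" \<Omega>] assms(1,2) by (simp add: indicator_unit_function)
qed

lemma indicator_space: "I (indicator (space \<Omega>)) = 1"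
  using cong[of "indicator (space \<Omega>)" "\<lambda>_. 1"] one
  by (simp add: indicator_unit_function const_unit_function)

lemma fin_add_prob: "(\<lambda>A\<in>sets \<Omega>. I (indicator A)) \<in> fin_add_probs \<Omega>"
  using nonneg[OF indicator_unit_function] le_one[OF indicator_unit_function]
  by (auto simp: fin_add_probs_def indicator_space indicator_Un)

text \<open>This push-forward later turns a mean on the codensity space into a mean on
  \<open>fin_giry \<Omega>\<close>.\<close>

lemma mean_image:
  assumes g: "g \<in> \<Omega> \<rightarrow>\<^sub>M N"
  shows "mean N (\<lambda>f. I (\<lambda>\<omega>. f (g \<omega>)))"
proof
  note u = unit_function_compose[OF _ g]
  show "I (\<lambda>\<omega>. f (g \<omega>)) = I (\<lambda>\<omega>. f' (g \<omega>))"
    if "f \<in> unit_functions N" "f' \<in> unit_functions N" "\<And>x. x \<in> space N \<Longrightarrow> f x = f' x" for f f'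
    using that measurable_space[OF g] by (intro cong u) auto
  show "I (\<lambda>\<omega>. f (g \<omega>) + f' (g \<omega>)) = I (\<lambda>\<omega>. f (g \<omega>)) + I (\<lambda>\<omega>. f' (g \<omega>))"
    if "f \<in> unit_functions N" "f' \<in> unit_functions N" "(\<lambda>x. f x + f' x) \<in> unit_functions N" for f f'
    using u[OF that(3)] by (intro add u that)
qed (auto intro: nonneg scale unit_function_compose[OF _ g] simp: one)

lemma indicator_vimage:
  assumes "g \<in> \<Omega> \<rightarrow>\<^sub>M N" "A \<in> sets N"
  shows "I (\<lambda>\<omega>. indicator A (g \<omega>)) = I (indicator (g -` A \<inter> space \<Omega>))"
  using assms
  by (intro cong unit_function_compose[OF indicator_unit_function] indicator_unit_function)
     (auto simp: indicator_def)

end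

section \<open>Integration against finitely additive probabilities\<close>

text \<open>The quantity inside the supremum of \<open>fin_add_integral\<close>, isolated so that
  its linearity can be proved before any supremum is taken.\<close>

definition simple_sum :: "'a measure \<Rightarrow> ('a set \<Rightarrow> real) \<Rightarrow> ('a \<Rightarrow> real) \<Rightarrow> real" where
  "simple_sum \<Omega> \<pi> s = (\<Sum>a \<in> s ` space \<Omega>. a * \<pi> (s -` {a} \<inter> space \<Omega>))"

context
  fixes \<Omega> :: "'a measure" and \<pi> :: "'a set \<Rightarrow> real"
  assumes \<pi>: "\<pi> \<in> fin_add_probs \<Omega>"
begin

lemma fin_add_Un: "A \<in> sets \<Omega> \<Longrightarrow> B \<in> sets \<Omega> \<Longrightarrow> A \<inter> B = {} \<Longrightarrow> \<pi> (A \<union> B) = \<pi> A + \<pi> B"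
  using \<pi> by (simp add: fin_add_probs_def)

lemma fin_add_nonneg: "A \<in> sets \<Omega> \<Longrightarrow> 0 \<le> \<pi> A"
  using \<pi> by (auto simp: fin_add_probs_def)

lemma fin_add_empty: "\<pi> {} = 0"
  using fin_add_Un[of "{}" "{}"] by simp

lemma fin_add_UN:
  assumes "finite S" "\<And>i. i \<in> S \<Longrightarrow> B i \<in> sets \<Omega>" "disjoint_family_on B S"
  shows "\<pi> (\<Union>i\<in>S. B i) = (\<Sum>i\<in>S. \<pi> (B i))"
  using assms
proof (induction S)
  case (insert x S)
  then have "\<pi> (B x \<union> (\<Union>i\<in>S. B i)) = \<pi> (B x) + \<pi> (\<Union>i\<in>S. B i)"
    by (intro fin_add_Un sets.finite_UN) (auto simp: disjoint_family_on_def)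
  with insert show ?case by (simp add: disjoint_family_on_def)
qed (simp add: fin_add_empty)

text \<open>
  Taking \<open>s\<close> to be a tuple of simple functions turns their sums into sums over one common finite
  partition, where linearity and monotonicity are evident.
\<close>

lemma simple_sum_comp:
  assumes s: "simple_function \<Omega> s"
  shows "simple_sum \<Omega> \<pi> (\<lambda>\<omega>. \<phi> (s \<omega>)) = (\<Sum>e \<in> s ` space \<Omega>. \<phi> e * \<pi> (s -` {e} \<inter> space \<Omega>))"
proof -
  let ?X = "s ` space \<Omega>"
  let ?B = "\<lambda>e. s -` {e} \<inter> space \<Omega>"
  have fin: "finite ?X" and B: "\<And>e. e \<in> ?X \<Longrightarrow> ?B e \<in> sets \<Omega>"
    using s by (auto simp: simple_function_def)
  \<comment> \<open>The fibre of the composite over a is the disjoint union of the fibres of s over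
    the points that \<open>\<phi>\<close> sends to a.\<close>
  have "\<pi> ((\<lambda>\<omega>. \<phi> (s \<omega>)) -` {a} \<inter> space \<Omega>) = (\<Sum>e | e \<in> ?X \<and> \<phi> e = a. \<pi> (?B e))" for a
  proof -
    have "(\<lambda>\<omega>. \<phi> (s \<omega>)) -` {a} \<inter> space \<Omega> = (\<Union>e\<in>{e. e \<in> ?X \<and> \<phi> e = a}. ?B e)" by auto
    then show ?thesis
      by (simp only:) (rule fin_add_UN, use fin B in \<open>auto simp: disjoint_family_on_def\<close>)
  qed
  then have "simple_sum \<Omega> \<pi> (\<lambda>\<omega>. \<phi> (s \<omega>)) =
      (\<Sum>a \<in> \<phi> ` ?X. \<Sum>e | e \<in> ?X \<and> \<phi> e = a. \<phi> e * \<pi> (?B e))"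
    by (simp add: simple_sum_def image_image sum_distrib_left)
  also have "\<dots> = (\<Sum>e \<in> ?X. \<phi> e * \<pi> (?B e))"
    by (rule sum.image_gen[OF fin, symmetric])
  finally show ?thesis .
qed

lemma simple_sum_add:
  assumes "simple_function \<Omega> r" "simple_function \<Omega> s"
  shows "simple_sum \<Omega> \<pi> (\<lambda>\<omega>. r \<omega> + s \<omega>) = simple_sum \<Omega> \<pi> r + simple_sum \<Omega> \<pi> s"
  using simple_sum_comp[OF simple_function_Pair[OF assms], of "\<lambda>e. fst e + snd e"]
    simple_sum_comp[OF simple_function_Pair[OF assms], of fst]
    simple_sum_comp[OF simple_function_Pair[OF assms], of snd]
  by (simp add: sum.distrib distrib_right)

lemma simple_sum_scale:
  assumes "simple_function \<Omega> s"
  shows "simple_sum \<Omega> \<pi> (\<lambda>\<omega>. c * s \<omega>) = c * simple_sum \<Omega> \<pi> s"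
  using simple_sum_comp[OF assms, of "\<lambda>e. c * e"]
  by (simp add: simple_sum_def sum_distrib_left mult.assoc)

lemma simple_sum_mono:
  assumes "simple_function \<Omega> r" "simple_function \<Omega> s" "\<And>\<omega>. \<omega> \<in> space \<Omega> \<Longrightarrow> r \<omega> \<le> s \<omega>"
  shows "simple_sum \<Omega> \<pi> r \<le> simple_sum \<Omega> \<pi> s"
proof -
  have p: "simple_function \<Omega> (\<lambda>\<omega>. (r \<omega>, s \<omega>))" by (rule simple_function_Pair[OF assms(1,2)])
  have "(\<Sum>e \<in> (\<lambda>\<omega>. (r \<omega>, s \<omega>)) ` space \<Omega>. fst e * \<pi> ((\<lambda>\<omega>. (r \<omega>, s \<omega>)) -` {e} \<inter> space \<Omega>)) \<le>
     (\<Sum>e \<in> (\<lambda>\<omega>. (r \<omega>, s \<omega>)) ` space \<Omega>. snd e * \<pi> ((\<lambda>\<omega>. (r \<omega>, s \<omega>)) -` {e} \<inter> space \<Omega>))"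
    by (rule sum_mono, rule mult_right_mono)
       (use assms(3) p in \<open>auto simp: simple_function_def intro!: fin_add_nonneg\<close>)
  then show ?thesis using simple_sum_comp[OF p, of fst] simple_sum_comp[OF p, of snd] by simp
qed

lemma simple_sum_const: "simple_sum \<Omega> \<pi> (\<lambda>_. c) = c"
proof -
  have 1: "\<pi> (space \<Omega>) = 1" using \<pi> by (simp add: fin_add_probs_def)
  \<comment> \<open>On an empty space the sum would be empty and give 0; total mass 1 rules this
    out.\<close>
  then have "space \<Omega> \<noteq> {}" using fin_add_empty by auto
  then have "(\<lambda>_. c) ` space \<Omega> = {c}" by auto
  with 1 show ?thesis by (simp add: simple_sum_def)
qed

lemma simple_sum_indicator:
  assumes "A \<in> sets \<Omega>"
  shows "simple_sum \<Omega> \<pi> (indicator A) = \<pi> A"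
proof -
  \<comment> \<open>The indicator factors through the Boolean-valued simple function of membership,
    so \<open>simple_sum_comp\<close> leaves a sum over at most two truth values.\<close>
  let ?s = "\<lambda>\<omega>. \<omega> \<in> A"
  have "?s -` {e} \<inter> space \<Omega> \<in> sets \<Omega>" for e
    using assms by (cases e) (auto simp: vimage_def)
  then have s: "simple_function \<Omega> ?s" by (simp add: simple_function_def)
  have "indicator A = (\<lambda>\<omega>. of_bool (?s \<omega>) :: real)" by (auto simp: fun_eq_iff)
  then have "simple_sum \<Omega> \<pi> (indicator A) =
      (\<Sum>e \<in> ?s ` space \<Omega>. of_bool e * \<pi> (?s -` {e} \<inter> space \<Omega>))"
    using simple_sum_comp[OF s, of of_bool] by simp
  \<comment> \<open>False has coefficient 0, and if True is not attained its fibre is empty and has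
    mass 0. So the sum may be taken over True alone.\<close>
  also have "\<dots> = (\<Sum>e \<in> {True}. of_bool e * \<pi> (?s -` {e} \<inter> space \<Omega>))"
  proof (rule sum.mono_neutral_cong)
    show "of_bool i * \<pi> (?s -` {i} \<inter> space \<Omega>) = 0" if "i \<in> {True} - ?s ` space \<Omega>" for i
    proof -
      have "?s -` {i} \<inter> space \<Omega> = {}" using that by auto
      then show ?thesis by (simp only: fin_add_empty)
    qed
  qed auto
  also have "\<dots> = \<pi> A"
  proof -
    have "?s -` {True} \<inter> space \<Omega> = A" using sets.sets_into_space[OF assms] by auto
    then show ?thesis by simp
  qed
  finally show ?thesis .
qed

text \<open>A supremum of reals dominates its members only if the set is bounded above. Simple
  functions below f are below 1, so all their sums are at most 1.\<close>

lemma simple_sum_le_fin_add_integral: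
  assumes "f \<in> unit_functions \<Omega>" "simple_function \<Omega> s" "\<And>\<omega>. \<omega> \<in> space \<Omega> \<Longrightarrow> s \<omega> \<le> f \<omega>"
  shows "simple_sum \<Omega> \<pi> s \<le> fin_add_integral \<Omega> \<pi> f"
  unfolding fin_add_integral_def simple_sum_def[symmetric]
proof (rule cSUP_upper)
  have "simple_sum \<Omega> \<pi> r \<le> 1"
    if "simple_function \<Omega> r" "\<forall>\<omega>\<in>space \<Omega>. r \<omega> \<le> f \<omega>" for r
    using simple_sum_mono[OF that(1), of "\<lambda>_. 1"] that(2) unit_functionsD(3)[OF assms(1)]
    by (fastforce simp: simple_sum_const)
  then show "bdd_above (simple_sum \<Omega> \<pi> ` {s. simple_function \<Omega> s \<and> (\<forall>\<omega>\<in>space \<Omega>. s \<omega> \<le> f \<omega>)})"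
    by (intro bdd_aboveI2[where M = 1]) auto
qed (use assms in auto)

text \<open>Every simple function below f is below s + e. Together with the preceding lower bound
  this confines the integral to an interval of length e.\<close>

lemma fin_add_integral_le:
  assumes "f \<in> unit_functions \<Omega>" "simple_function \<Omega> s" "\<And>\<omega>. \<omega> \<in> space \<Omega> \<Longrightarrow> f \<omega> \<le> s \<omega> + e"
  shows "fin_add_integral \<Omega> \<pi> f \<le> simple_sum \<Omega> \<pi> s + e"
  unfolding fin_add_integral_def simple_sum_def[symmetric]
proof (rule cSUP_least)
  show "{s. simple_function \<Omega> s \<and> (\<forall>\<omega>\<in>space \<Omega>. s \<omega> \<le> f \<omega>)} \<noteq> {}"
    \<comment> \<open>The zero function shows that the supremum is not over the empty set.\<close>
    using unit_functionsD(2)[OF assms(1)] by (auto intro!: exI[of _ "\<lambda>_. 0"])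
  fix r assume r: "r \<in> {s. simple_function \<Omega> s \<and> (\<forall>\<omega>\<in>space \<Omega>. s \<omega> \<le> f \<omega>)}"
  have "simple_sum \<Omega> \<pi> r \<le> simple_sum \<Omega> \<pi> (\<lambda>\<omega>. s \<omega> + e)"
    by (rule simple_sum_mono) (use r assms in \<open>fastforce intro: order_trans\<close>)+
  then show "simple_sum \<Omega> \<pi> r \<le> simple_sum \<Omega> \<pi> s + e"
    by (simp add: simple_sum_add assms(2) simple_sum_const)
qed

lemma simple_approx:
  assumes f: "f \<in> unit_functions \<Omega>" and e: "0 < e"
  shows "\<exists>s. simple_function \<Omega> s \<and> (\<forall>\<omega>\<in>space \<Omega>. s \<omega> \<le> f \<omega> \<and> f \<omega> \<le> s \<omega> + e)"
proof (intro exI conjI ballI)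
  note fD = unit_functionsD[OF f]
  \<comment> \<open>This is f rounded down to a multiple of e. The factors range over the integers
    from 0 to the floor of 1 / e, hence over a finite set.\<close>
  let ?s = "\<lambda>\<omega>. e * of_int \<lfloor>f \<omega> / e\<rfloor>"
  show "simple_function \<Omega> ?s"
  proof (rule simple_function_borel_measurable)
    show "?s \<in> borel_measurable \<Omega>" using fD(1) by measurable
    have "?s ` space \<Omega> \<subseteq> (\<lambda>i. e * of_int i) ` {0..\<lfloor>1 / e\<rfloor>}"
      using fD(2,3) e by (auto intro!: imageI floor_mono divide_right_mono)
    then show "finite (?s ` space \<Omega>)" by (rule finite_subset) simp
  qed
  have "of_int \<lfloor>f \<omega> / e\<rfloor> \<le> f \<omega> / e" "f \<omega> / e \<le> of_int \<lfloor>f \<omega> / e\<rfloor> + 1" for \<omega>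
    by linarith+
  from mult_left_mono[OF this(1), of e] mult_left_mono[OF this(2), of e]
  show "?s \<omega> \<le> f \<omega>" "f \<omega> \<le> ?s \<omega> + e" for \<omega>
    using e by (simp_all add: distrib_left)
qed

text \<open>A simple function approximates itself with error 0, so the upper and lower bounds
  meet.\<close>

lemma fin_add_integral_simple:
  assumes "simple_function \<Omega> s" "s \<in> unit_functions \<Omega>"
  shows "fin_add_integral \<Omega> \<pi> s = simple_sum \<Omega> \<pi> s"
  using simple_sum_le_fin_add_integral[OF assms(2,1)] fin_add_integral_le[OF assms(2,1), of 0] by simp

lemma fin_add_integral_indicator: "A \<in> sets \<Omega> \<Longrightarrow> fin_add_integral \<Omega> \<pi> (indicator A) = \<pi> A"
  by (simp add: fin_add_integral_simple indicator_unit_function simple_sum_indicator)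

text \<open>Additivity and homogeneity pass from simple sums to integrals up to an arbitrarily small
  e, by approximation with simple functions from below.\<close>

lemma mean_fin_add_integral: "mean \<Omega> (fin_add_integral \<Omega> \<pi>)"
proof
  let ?J = "fin_add_integral \<Omega> \<pi>"
  let ?\<Sigma> = "simple_sum \<Omega> \<pi>"
  show "?J f = ?J g" if "\<And>\<omega>. \<omega> \<in> space \<Omega> \<Longrightarrow> f \<omega> = g \<omega>" for f g
    using that by (simp add: fin_add_integral_def cong: conj_cong)
  show "0 \<le> ?J f" if "f \<in> unit_functions \<Omega>" for f
    using simple_sum_le_fin_add_integral[OF that, of "\<lambda>_. 0"] unit_functionsD(2)[OF that]
    by (simp add: simple_sum_const)
  show "?J (\<lambda>_. 1) = 1"
    using fin_add_integral_simple[of "\<lambda>_. 1"] by (simp add: simple_sum_const const_unit_function)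
  fix f assume f: "f \<in> unit_functions \<Omega>"
  show "?J (\<lambda>\<omega>. f \<omega> + g \<omega>) = ?J f + ?J g"
    if g: "g \<in> unit_functions \<Omega>" and fg: "(\<lambda>\<omega>. f \<omega> + g \<omega>) \<in> unit_functions \<Omega>" for g
  proof -
    have "\<bar>?J (\<lambda>\<omega>. f \<omega> + g \<omega>) - (?J f + ?J g)\<bar> \<le> 0 + e" if "0 < e" for e
    proof -
      \<comment> \<open>Each of the two functions is approximated within half of e, so their sum is
        approximated within e.\<close>
      have e: "0 < e / 2" using that by simp
      obtain r where r: "simple_function \<Omega> r"
          "\<forall>\<omega>\<in>space \<Omega>. r \<omega> \<le> f \<omega> \<and> f \<omega> \<le> r \<omega> + e / 2"
        using simple_approx[OF f e] by blast
      then have r': "\<And>\<omega>. \<omega> \<in> space \<Omega> \<Longrightarrow> r \<omega> \<le> f \<omega>"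
          "\<And>\<omega>. \<omega> \<in> space \<Omega> \<Longrightarrow> f \<omega> \<le> r \<omega> + e / 2"
        by auto
      obtain s where s: "simple_function \<Omega> s"
          "\<forall>\<omega>\<in>space \<Omega>. s \<omega> \<le> g \<omega> \<and> g \<omega> \<le> s \<omega> + e / 2"
        using simple_approx[OF g e] by blast
      then have s': "\<And>\<omega>. \<omega> \<in> space \<Omega> \<Longrightarrow> s \<omega> \<le> g \<omega>"
          "\<And>\<omega>. \<omega> \<in> space \<Omega> \<Longrightarrow> g \<omega> \<le> s \<omega> + e / 2"
        by auto
      have rs: "simple_function \<Omega> (\<lambda>\<omega>. r \<omega> + s \<omega>)" using r(1) s(1) by simp
      have "?\<Sigma> (\<lambda>\<omega>. r \<omega> + s \<omega>) \<le> ?J (\<lambda>\<omega>. f \<omega> + g \<omega>)"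
        by (rule simple_sum_le_fin_add_integral[OF fg rs]) (use r' s' in \<open>auto intro: add_mono\<close>)
      moreover have "?J (\<lambda>\<omega>. f \<omega> + g \<omega>) \<le> ?\<Sigma> (\<lambda>\<omega>. r \<omega> + s \<omega>) + e"
      proof (rule fin_add_integral_le[OF fg rs])
        show "f \<omega> + g \<omega> \<le> r \<omega> + s \<omega> + e" if "\<omega> \<in> space \<Omega>" for \<omega>
          using r'(2)[OF that] s'(2)[OF that] by linarith
      qed
      ultimately show ?thesis
        using simple_sum_le_fin_add_integral[OF f r(1) r'(1)] fin_add_integral_le[OF f r(1) r'(2)]
          simple_sum_le_fin_add_integral[OF g s(1) s'(1)] fin_add_integral_le[OF g s(1) s'(2)]
        unfolding simple_sum_add[OF r(1) s(1)] by linarith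
    qed
    then have "\<bar>?J (\<lambda>\<omega>. f \<omega> + g \<omega>) - (?J f + ?J g)\<bar> \<le> 0" by (rule field_le_epsilon)
    then show ?thesis by simp
  qed
  show "?J (\<lambda>\<omega>. c * f \<omega>) = c * ?J f" if c: "c \<in> {0..1}" for c
  proof -
    have "\<bar>?J (\<lambda>\<omega>. c * f \<omega>) - c * ?J f\<bar> \<le> 0 + e" if e: "0 < e" for e
    proof -
      obtain s where s: "simple_function \<Omega> s"
          "\<forall>\<omega>\<in>space \<Omega>. s \<omega> \<le> f \<omega> \<and> f \<omega> \<le> s \<omega> + e"
        using simple_approx[OF f e] by blast
      then have s': "\<And>\<omega>. \<omega> \<in> space \<Omega> \<Longrightarrow> s \<omega> \<le> f \<omega>"
          "\<And>\<omega>. \<omega> \<in> space \<Omega> \<Longrightarrow> f \<omega> \<le> s \<omega> + e"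
        by auto
      have ce: "c * e \<le> e" "0 \<le> c" using c e by (auto intro: mult_left_le_one_le)
      have cs: "simple_function \<Omega> (\<lambda>\<omega>. c * s \<omega>)" using s(1) by simp
      note cf = scale_unit_function[OF f c]
      have "?\<Sigma> (\<lambda>\<omega>. c * s \<omega>) \<le> ?J (\<lambda>\<omega>. c * f \<omega>)"
        by (rule simple_sum_le_fin_add_integral[OF cf cs]) (use s' ce in \<open>auto intro: mult_left_mono\<close>)
      moreover have "?J (\<lambda>\<omega>. c * f \<omega>) \<le> ?\<Sigma> (\<lambda>\<omega>. c * s \<omega>) + c * e"
        by (rule fin_add_integral_le[OF cf cs])
           (use mult_left_mono[OF s'(2) ce(2)] in \<open>simp add: distrib_left\<close>)
      moreover have "c * ?\<Sigma> s \<le> c * ?J f" "c * ?J f \<le> c * (?\<Sigma> s + e)"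
        using simple_sum_le_fin_add_integral[OF f s(1) s'(1)] fin_add_integral_le[OF f s(1) s'(2)]
        by (simp_all only: mult_left_mono[OF _ ce(2)])
      ultimately show ?thesis
        using ce unfolding simple_sum_scale[OF s(1)] distrib_left by linarith
    qed
    then have "\<bar>?J (\<lambda>\<omega>. c * f \<omega>) - c * ?J f\<bar> \<le> 0" by (rule field_le_epsilon)
    then show ?thesis by simp
  qed
qed

end

text \<open>Integral representation of means: the right-hand side is itself a mean and agrees with
  \<open>I\<close> on indicators.\<close>

lemma (in mean) eq_fin_add_integral:
  assumes "f \<in> unit_functions \<Omega>"
  shows "I f = fin_add_integral \<Omega> (\<lambda>A\<in>sets \<Omega>. I (indicator A)) f"
  by (rule eqI_indicator[OF mean_fin_add_integral[OF fin_add_prob] _ assms])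
     (simp add: fin_add_integral_indicator[OF fin_add_prob])

text \<open>The pointwise maximum is the minimum plus the absolute difference, and
  \<open>I f\<close> and \<open>I g\<close> both lie between the means of the minimum and the
  maximum. This avoids the signed difference, which may leave I.\<close>

lemma (in mean) abs_diff_le:
  assumes f: "f \<in> unit_functions \<Omega>" and g: "g \<in> unit_functions \<Omega>"
  shows "(\<lambda>\<omega>. \<bar>f \<omega> - g \<omega>\<bar>) \<in> unit_functions \<Omega>"
    and "\<bar>I f - I g\<bar> \<le> I (\<lambda>\<omega>. \<bar>f \<omega> - g \<omega>\<bar>)"
proof -
  let ?d = "\<lambda>\<omega>. \<bar>f \<omega> - g \<omega>\<bar>"
  let ?m = "\<lambda>\<omega>. min (f \<omega>) (g \<omega>)"
  let ?M = "\<lambda>\<omega>. max (f \<omega>) (g \<omega>)"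
  note meas = unit_functionsD(1)[OF f] unit_functionsD(1)[OF g]
  note rng = unit_functionsD(2,3)[OF f] unit_functionsD(2,3)[OF g]
  show d: "?d \<in> unit_functions \<Omega>"
  proof (rule unit_functionsI)
    show "?d \<in> borel_measurable \<Omega>" using meas by measurable
    show "0 \<le> ?d \<omega> \<and> ?d \<omega> \<le> 1" if "\<omega> \<in> space \<Omega>" for \<omega>
      using rng[OF that] by (auto simp: abs_le_iff)
  qed
  have m: "?m \<in> unit_functions \<Omega>"
    by (rule unit_functionsI) (use meas rng in \<open>auto simp: min_def\<close>)
  have M: "?M \<in> unit_functions \<Omega>"
    by (rule unit_functionsI) (use meas rng in \<open>auto simp: max_def\<close>)
  have eq: "?M = (\<lambda>\<omega>. ?m \<omega> + ?d \<omega>)" by (auto simp: fun_eq_iff)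
  have "I ?M = I ?m + I ?d"
    using add[OF m d] M unfolding eq by blast
  moreover have "I ?m \<le> I f" "I ?m \<le> I g" "I f \<le> I ?M" "I g \<le> I ?M"
    by (rule mono; use m M f g in simp)+
  ultimately show "\<bar>I f - I g\<bar> \<le> I ?d" by linarith
qed

section \<open>Affine functionals on the objects\<close>

text \<open>The index set of the genuine coordinates of a point. It lets cubes and d_0 be treated
  alike, with convergence to 0 as the one extra condition on d_0.\<close>

fun dims :: "cobj \<Rightarrow> nat set" where
  "dims (Cube n) = {..<n}"
| "dims Null_seqs = UNIV"

lemma in_space_cobj_space_iff:
  "x \<in> space (cobj_space a) \<longleftrightarrow>
     (\<forall>i\<in>dims a. 0 \<le> x i \<and> x i \<le> 1) \<and> x \<in> extensional (dims a) \<and> (a = Null_seqs \<longrightarrow> x \<longlonglongrightarrow> 0)"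
  by (cases a) (auto simp: space_PiM space_restrict_space PiE_iff)

declare cobj_space.simps [simp del]

lemma component_unit_function:
  assumes "i \<in> dims a"
  shows "(\<lambda>x. x i) \<in> unit_functions (cobj_space a)"
proof (rule unit_functionsI)
  have "(\<lambda>x. x i) \<in> cobj_space a \<rightarrow>\<^sub>M unit_interval"
  proof (cases a)
    case (Cube n)
    with assms show ?thesis by (auto simp: cobj_space.simps intro: measurable_component_singleton)
  next
    case Null_seqs
    then show ?thesis by (auto simp: cobj_space.simps intro: measurable_restrict_space1 measurable_component_singleton)
  qed
  then show "(\<lambda>x. x i) \<in> borel_measurable (cobj_space a)"
    by (simp add: measurable_restrict_space2_iff)
qed (use assms in \<open>simp add: in_space_cobj_space_iff\<close>)

lemma measurable_into_cobj_space:
  assumes sp: "\<And>x. x \<in> space X \<Longrightarrow> h x \<in> space (cobj_space a)"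
    and comp: "\<And>i. i \<in> dims a \<Longrightarrow> (\<lambda>x. h x i) \<in> borel_measurable X"
  shows "h \<in> X \<rightarrow>\<^sub>M cobj_space a"
proof -
  have "h \<in> X \<rightarrow>\<^sub>M (\<Pi>\<^sub>M i\<in>dims a. unit_interval)"
  proof (rule measurable_PiM_single')
    show "(\<lambda>x. h x i) \<in> X \<rightarrow>\<^sub>M unit_interval" if "i \<in> dims a" for i
      by (rule measurable_restrict_space2[OF _ comp[OF that]])
         (use sp that in \<open>auto simp: in_space_cobj_space_iff\<close>)
    show "(\<lambda>i. h i) \<in> space X \<rightarrow> (\<Pi>\<^sub>E i\<in>dims a. space unit_interval)"
      using sp by (auto simp: in_space_cobj_space_iff PiE_iff)
  qed
  moreover have "h x \<longlonglongrightarrow> 0" if "a = Null_seqs" "x \<in> space X" for x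
    using sp[OF that(2)] that(1) by (simp add: in_space_cobj_space_iff)
  ultimately show ?thesis
    by (cases a) (auto intro!: measurable_restrict_space2 simp: cobj_space.simps)
qed

text \<open>An affine map from the object to I, with I taken as a set of reals;
  \<open>affine_functional_map\<close> turns it into a morphism to \<open>Cube 1\<close>.\<close>

definition affine_functional :: "cobj \<Rightarrow> ((nat \<Rightarrow> real) \<Rightarrow> real) \<Rightarrow> bool" where
  "affine_functional a g \<longleftrightarrow>
     (\<forall>x\<in>space (cobj_space a). 0 \<le> g x \<and> g x \<le> 1) \<and>
     (\<forall>x\<in>space (cobj_space a). \<forall>y\<in>space (cobj_space a). \<forall>r\<in>{0..1}.
        g (\<lambda>i. r * x i + (1 - r) * y i) = r * g x + (1 - r) * g y)"

lemma affine_map_component: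
  assumes "h \<in> affine_maps a b" "i \<in> dims b"
  shows "affine_functional a (\<lambda>x. h x i)"
proof -
  have "0 \<le> h x i \<and> h x i \<le> 1" if "x \<in> space (cobj_space a)" for x
  proof -
    have "h x \<in> space (cobj_space b)" using assms(1) that by (auto simp: affine_maps_def)
    with assms(2) show ?thesis by (simp add: in_space_cobj_space_iff)
  qed
  with assms(1) show ?thesis by (simp add: affine_functional_def affine_maps_def)
qed

lemma affine_functional_map:
  assumes "affine_functional a g"
  shows "(\<lambda>x. \<lambda>i\<in>{..<1}. g x) \<in> affine_maps a (Cube 1)"
proof -
  \<comment> \<open>This also covers indices other than 0: a convex combination of
    \<open>undefined\<close> with itself is \<open>undefined\<close>.\<close>
  have "(\<lambda>i\<in>{..<1::nat}. r * u + (1 - r) * v) =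
      (\<lambda>i. r * (\<lambda>i\<in>{..<1}. u) i + (1 - r) * (\<lambda>i\<in>{..<1}. v) i)" for r u v :: real
    by (auto simp: fun_eq_iff algebra_simps)
  with assms show ?thesis
    by (auto simp: affine_maps_def affine_functional_def in_space_cobj_space_iff)
qed

section \<open>Affine functionals evaluated along truncations\<close>

abbreviation origin :: "cobj \<Rightarrow> nat \<Rightarrow> real" where
  "origin a \<equiv> \<lambda>i\<in>dims a. 0"

abbreviation basis_point :: "cobj \<Rightarrow> nat \<Rightarrow> nat \<Rightarrow> real" where
  "basis_point a k \<equiv> \<lambda>i\<in>dims a. if i = k then 1 else 0"

abbreviation trunc :: "cobj \<Rightarrow> nat \<Rightarrow> (nat \<Rightarrow> real) \<Rightarrow> nat \<Rightarrow> real" where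
  "trunc a k x \<equiv> \<lambda>i\<in>dims a. if i < k then x i else 0"

context
  fixes a :: cobj and g :: "(nat \<Rightarrow> real) \<Rightarrow> real"
  assumes g: "affine_functional a g"
begin

lemma affine_functional_unit_function: "g \<in> unit_functions (cobj_space a)"
  using g by (auto simp: affine_functional_def intro!: unit_functionsI affine_functional_measurable)

lemma affine_functional_comb:
  "\<lbrakk>x \<in> space (cobj_space a); y \<in> space (cobj_space a); r \<in> {0..1}\<rbrakk> \<Longrightarrow>
   g (\<lambda>i. r * x i + (1 - r) * y i) = r * g x + (1 - r) * g y"
  using g by (simp add: affine_functional_def)

lemma eventually_zero_in_space:
  assumes "\<And>i. i \<in> dims a \<Longrightarrow> 0 \<le> x i \<and> x i \<le> 1" "\<And>i. i \<ge> k \<Longrightarrow> x i = 0"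
  shows "(\<lambda>i\<in>dims a. x i) \<in> space (cobj_space a)"
proof -
  have "x \<longlonglongrightarrow> 0"
    by (rule tendsto_eventually) (use assms(2) in \<open>auto simp: eventually_at_top_linorder\<close>)
  with assms(1) show ?thesis by (auto simp: in_space_cobj_space_iff restrict_UNIV)
qed

lemma origin_in_space: "origin a \<in> space (cobj_space a)"
  by (rule eventually_zero_in_space[of _ 0]) auto

lemma basis_point_in_space: "basis_point a k \<in> space (cobj_space a)"
  by (rule eventually_zero_in_space[of _ "Suc k"]) auto

lemma trunc_in_space: "x \<in> space (cobj_space a) \<Longrightarrow> trunc a k x \<in> space (cobj_space a)"
  by (rule eventually_zero_in_space[of _ k]) (auto simp: in_space_cobj_space_iff)

text \<open>The midpoint of w and the origin is also the midpoint of u and v, and affinity computes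
  g there in two ways.\<close>

lemma affine_functional_add:
  assumes "u \<in> space (cobj_space a)" "v \<in> space (cobj_space a)" "w \<in> space (cobj_space a)"
    and "\<And>i. i \<in> dims a \<Longrightarrow> w i = u i + v i"
  shows "g w + g (origin a) = g u + g v"
proof -
  have "(\<lambda>i. 1/2 * w i + (1 - 1/2) * (origin a) i) = (\<lambda>i. 1/2 * u i + (1 - 1/2) * v i)"
  proof
    fix i show "1/2 * w i + (1 - 1/2) * (origin a) i = 1/2 * u i + (1 - 1/2) * v i"
      using assms by (cases "i \<in> dims a") (auto simp: in_space_cobj_space_iff extensional_def)
  qed
  then show ?thesis
    using affine_functional_comb[OF assms(3) origin_in_space, of "1/2"]
      affine_functional_comb[OF assms(1,2), of "1/2"] by simp
qed

lemma affine_functional_scale: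
  assumes "x \<in> space (cobj_space a)" "r \<in> {0..1}"
  shows "(\<lambda>i\<in>dims a. r * x i) \<in> space (cobj_space a)"
    and "g (\<lambda>i\<in>dims a. r * x i) = g (origin a) + r * (g x - g (origin a))"
proof -
  have eq: "(\<lambda>i. r * x i + (1 - r) * (origin a) i) = (\<lambda>i\<in>dims a. r * x i)"
    using assms(1) by (auto simp: fun_eq_iff in_space_cobj_space_iff extensional_def algebra_simps)
  show "(\<lambda>i\<in>dims a. r * x i) \<in> space (cobj_space a)"
    using cobj_space_convex[OF assms(1) origin_in_space assms(2)] unfolding eq .
  show "g (\<lambda>i\<in>dims a. r * x i) = g (origin a) + r * (g x - g (origin a))"
    using affine_functional_comb[OF assms(1) origin_in_space assms(2)] unfolding eq
    by (simp add: algebra_simps)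
qed

text \<open>The longer truncation is the shorter one plus \<open>x k\<close> times a basis point.
  The increment is linear in \<open>x k\<close> with a slope independent of x, so a mean can be
  applied to it.\<close>

lemma affine_functional_trunc_Suc:
  assumes x: "x \<in> space (cobj_space a)" and k: "k \<in> dims a"
  shows "g (trunc a (Suc k) x) = g (trunc a k x) + x k * (g (basis_point a k) - g (origin a))"
proof -
  have r: "x k \<in> {0..1}" using x k by (simp add: in_space_cobj_space_iff)
  note s = affine_functional_scale[OF basis_point_in_space[of k] r]
  have "g (trunc a (Suc k) x) + g (origin a) = g (trunc a k x) + g (\<lambda>i\<in>dims a. x k * (basis_point a k) i)"
    by (rule affine_functional_add[OF trunc_in_space[OF x] s(1) trunc_in_space[OF x]])
       (auto simp: less_Suc_eq)
  then show ?thesis using s(2) by simp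
qed

text \<open>The tail of a null sequence is \<open>d\<close> times a point of \<open>d\<^sub>0\<close> once its terms are below \<open>d\<close>.\<close>

lemma affine_functional_trunc_LIMSEQ:
  assumes a: "a = Null_seqs" and x: "x \<in> space (cobj_space a)"
  shows "(\<lambda>k. g (trunc a k x)) \<longlonglongrightarrow> g x"
proof (rule LIMSEQ_I)
  fix \<epsilon> :: real assume "0 < \<epsilon>"
  \<comment> \<open>The factor d must lie in I to be an admissible scalar, and the halving makes the
    final bound strict.\<close>
  define d where "d = min (\<epsilon> / 2) 1"
  have d: "0 < d" "d \<le> 1" "d < \<epsilon>" using \<open>0 < \<epsilon>\<close> by (auto simp: d_def min_def)
  have x0: "x \<longlonglongrightarrow> 0" and x01: "\<And>i. 0 \<le> x i \<and> x i \<le> 1"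
    using x a by (auto simp: in_space_cobj_space_iff)
  obtain N where N: "\<And>i. i \<ge> N \<Longrightarrow> x i < d"
    using LIMSEQ_D[OF x0 d(1)] by (auto dest: abs_less_iff[THEN iffD1])
  have "norm (g (trunc a k x) - g x) < \<epsilon>" if "k \<ge> N" for k
  proof -
    define y where "y = (\<lambda>i. if i < k then 0 else x i / d)"
    have "(\<lambda>i. x i / d) \<longlonglongrightarrow> 0" using tendsto_divide[OF x0 tendsto_const[of d]] d by simp
    moreover have "eventually (\<lambda>i. x i / d = y i) sequentially"
      unfolding eventually_at_top_linorder by (rule exI[of _ k]) (simp add: y_def)
    ultimately have "y \<longlonglongrightarrow> 0" by (rule Lim_transform_eventually)
    moreover have "0 \<le> y i \<and> y i \<le> 1" for i
      using x01[of i] N[of i] that d(1) by (auto simp: y_def intro: less_imp_le)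
    ultimately have y: "y \<in> space (cobj_space a)" by (simp add: in_space_cobj_space_iff a)
    have r: "d \<in> {0..1}" using d by simp
    note s = affine_functional_scale[OF y r]
    have "g x + g (origin a) = g (trunc a k x) + g (\<lambda>i\<in>dims a. d * y i)"
      by (rule affine_functional_add[OF trunc_in_space[OF x] s(1) x])
         (use d in \<open>auto simp: y_def\<close>)
    then have "norm (g (trunc a k x) - g x) = d * \<bar>g y - g (origin a)\<bar>"
      using s(2) d(1) by (simp add: abs_mult)
    also have "\<dots> \<le> d * 1"
      using unit_functionsD(2,3)[OF affine_functional_unit_function y]
        unit_functionsD(2,3)[OF affine_functional_unit_function origin_in_space] d(1)
      by (intro mult_left_mono) (auto simp: abs_le_iff)
    finally show ?thesis using d by simp
  qed
  then show "\<exists>N. \<forall>k\<ge>N. norm (g (trunc a k x) - g x) < \<epsilon>" by blast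
qed

end

section \<open>Barycentres\<close>

text \<open>Pointwise null sequences of maps into I amount to measurable maps into d_0. The
  condition thus says that coordinatewise means of such a map again form a null sequence.\<close>

definition null_continuous :: "'a measure \<Rightarrow> (('a \<Rightarrow> real) \<Rightarrow> real) \<Rightarrow> bool" where
  "null_continuous \<Omega> I \<longleftrightarrow>
     (\<forall>f. (\<forall>n. f n \<in> unit_functions \<Omega>) \<longrightarrow> (\<forall>\<omega>\<in>space \<Omega>. (\<lambda>n. f n \<omega>) \<longlonglongrightarrow> 0) \<longrightarrow>
        (\<lambda>n :: nat. I (f n)) \<longlonglongrightarrow> 0)"

lemma null_continuousD:
  "\<lbrakk>null_continuous \<Omega> I; \<And>n. f n \<in> unit_functions \<Omega>; \<And>\<omega>. \<omega> \<in> space \<Omega> \<Longrightarrow> (\<lambda>n. f n \<omega>) \<longlonglongrightarrow> 0\<rbrakk>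
   \<Longrightarrow> (\<lambda>n. I (f n)) \<longlonglongrightarrow> 0"
  by (simp add: null_continuous_def)

text \<open>When \<open>I\<close> is integration against a probability, this is the barycentre of
  the image of that probability under f.\<close>

definition barycentre :: "(('a \<Rightarrow> real) \<Rightarrow> real) \<Rightarrow> cobj \<Rightarrow> ('a \<Rightarrow> nat \<Rightarrow> real) \<Rightarrow> nat \<Rightarrow> real" where
  "barycentre I a f = (\<lambda>i\<in>dims a. I (\<lambda>\<omega>. f \<omega> i))"

lemma component_comp_unit_function:
  assumes "f \<in> \<Omega> \<rightarrow>\<^sub>M cobj_space a" "i \<in> dims a"
  shows "(\<lambda>\<omega>. f \<omega> i) \<in> unit_functions \<Omega>"
  by (rule unit_function_compose[OF component_unit_function[OF assms(2)] assms(1)])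

context mean
begin

context
  fixes a :: cobj and f :: "'a \<Rightarrow> nat \<Rightarrow> real"
  assumes f: "f \<in> \<Omega> \<rightarrow>\<^sub>M cobj_space a"
    and null: "a = Null_seqs \<Longrightarrow> null_continuous \<Omega> I"
begin

text \<open>For d_0 the coordinates must also tend to 0, which is \<open>null_continuous\<close>
  applied to the sequence of coordinates of f.\<close>

lemma barycentre_in_space: "barycentre I a f \<in> space (cobj_space a)"
proof -
  note c = component_comp_unit_function[OF f]
  have "(\<lambda>i. I (\<lambda>\<omega>. f \<omega> i)) \<longlonglongrightarrow> 0" if "a = Null_seqs"
    by (rule null_continuousD[OF null[OF that] c])
       (use that measurable_space[OF f] in \<open>auto simp: in_space_cobj_space_iff\<close>)
  then show ?thesis
    using nonneg[OF c] le_one[OF c] by (auto simp: in_space_cobj_space_iff barycentre_def restrict_UNIV)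
qed

text \<open>The functional commutes with the mean on each truncation by induction, since one more
  coordinate adds a multiple of that coordinate. On a cube some truncation is the identity. On d_0
  the truncations converge pointwise, and null continuity carries the limit through the
  mean.\<close>

lemma affine_functional_barycentre:
  assumes g: "affine_functional a g"
  shows "I (\<lambda>\<omega>. g (f \<omega>)) = g (barycentre I a f)"
proof -
  let ?b = "barycentre I a f"
  note fS = measurable_space[OF f]
  have tr: "trunc a k \<in> cobj_space a \<rightarrow>\<^sub>M cobj_space a" for k
  proof (rule measurable_into_cobj_space)
    show "(\<lambda>x. trunc a k x i) \<in> borel_measurable (cobj_space a)" if "i \<in> dims a" for i
      using unit_functionsD(1)[OF component_unit_function[OF that]] that by simp
  qed (rule trunc_in_space[OF g])
  have gf: "(\<lambda>\<omega>. g (f \<omega>)) \<in> unit_functions \<Omega>"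
    by (rule unit_function_compose[OF affine_functional_unit_function[OF g] f])
  have gt: "(\<lambda>\<omega>. g (trunc a k (f \<omega>))) \<in> unit_functions \<Omega>" for k
    by (rule unit_function_compose[OF unit_function_compose[OF affine_functional_unit_function[OF g] tr] f])
  have step: "I (\<lambda>\<omega>. g (trunc a k (f \<omega>))) = g (trunc a k ?b)" for k
  proof (induction k)
    case 0
    have "g (origin a) \<in> {0..1}"
      using unit_functionsD(2,3)[OF affine_functional_unit_function[OF g] origin_in_space[OF g]] by simp
    moreover have "trunc a 0 x = origin a" for x by simp
    ultimately show ?case by (simp only: const)
  next
    case (Suc k)
    show ?case
    proof (cases "k \<in> dims a")
      case True
      \<comment> \<open>The slope of g in direction k. As a difference of two values in I it lies
        between -1 and 1 and can be negative.\<close>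
      define c where "c = g (\<lambda>i\<in>dims a. if i = k then 1 else 0) - g (\<lambda>i\<in>dims a. 0)"
      have c: "c \<le> 1" "- c \<le> 1"
        using unit_functionsD(2,3)[OF affine_functional_unit_function[OF g] origin_in_space[OF g]]
          unit_functionsD(2,3)[OF affine_functional_unit_function[OF g] basis_point_in_space[OF g, of k]]
        by (simp_all add: c_def)
      note fk = component_comp_unit_function[OF f True]
      have bk: "?b k = I (\<lambda>\<omega>. f \<omega> k)" using True by (simp add: barycentre_def)
      have S: "g (trunc a (Suc k) x) = g (trunc a k x) + x k * c" if "x \<in> space (cobj_space a)" for x
        unfolding c_def by (rule affine_functional_trunc_Suc[OF g that True])
      have "I (\<lambda>\<omega>. g (trunc a (Suc k) (f \<omega>))) = I (\<lambda>\<omega>. g (trunc a k (f \<omega>))) + c * I (\<lambda>\<omega>. f \<omega> k)"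
      proof (cases "c \<ge> 0")
        case True
        with c have c01: "c \<in> {0..1}" by simp
        have eq: "g (trunc a (Suc k) (f \<omega>)) = g (trunc a k (f \<omega>)) + c * f \<omega> k" if "\<omega> \<in> space \<Omega>" for \<omega>
          using S[OF fS[OF that]] by (simp add: mult.commute)
        have u: "(\<lambda>\<omega>. g (trunc a k (f \<omega>)) + c * f \<omega> k) \<in> unit_functions \<Omega>"
          using unit_functionsD[OF gt[of "Suc k"]] unit_functionsD(1)[OF gt[of k]] unit_functionsD(1)[OF fk] eq
          by (intro unit_functionsI) auto
        have "I (\<lambda>\<omega>. g (trunc a (Suc k) (f \<omega>))) = I (\<lambda>\<omega>. g (trunc a k (f \<omega>)) + c * f \<omega> k)"
          by (rule cong[OF gt u eq])
        then show ?thesis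
          using add[OF gt scale_unit_function[OF fk c01] u] scale[OF fk c01] by simp
      next
        \<comment> \<open>For a negative slope \<open>c * f \<omega> k\<close> need not lie in I, so
          the term is moved to the other side, where its factor is -c.\<close>
        case False
        with c have c01: "- c \<in> {0..1}" by simp
        have eq: "g (trunc a k (f \<omega>)) = g (trunc a (Suc k) (f \<omega>)) + - c * f \<omega> k" if "\<omega> \<in> space \<Omega>" for \<omega>
          using S[OF fS[OF that]] by (simp add: mult.commute)
        have u: "(\<lambda>\<omega>. g (trunc a (Suc k) (f \<omega>)) + - c * f \<omega> k) \<in> unit_functions \<Omega>"
          using unit_functionsD[OF gt[of k]] unit_functionsD(1)[OF gt[of "Suc k"]] unit_functionsD(1)[OF fk] eq
          by (intro unit_functionsI) auto
        have "I (\<lambda>\<omega>. g (trunc a k (f \<omega>))) = I (\<lambda>\<omega>. g (trunc a (Suc k) (f \<omega>)) + - c * f \<omega> k)"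
          by (rule cong[OF gt u eq])
        then show ?thesis
          using add[OF gt scale_unit_function[OF fk c01] u] scale[OF fk c01] by simp
      qed
      then show ?thesis
        by (simp only: Suc.IH S[OF barycentre_in_space] bk mult.commute)
    next
      case False
      then have "trunc a (Suc k) x = trunc a k x" for x by (auto simp: fun_eq_iff less_Suc_eq)
      then show ?thesis by (simp only: Suc.IH)
    qed
  qed
  show ?thesis
  proof (cases a)
    case (Cube n)
    have "trunc a n x = x" if "x \<in> space (cobj_space a)" for x
      using that Cube by (auto simp: in_space_cobj_space_iff fun_eq_iff extensional_def)
    then have eq: "g (trunc a n x) = g x" if "x \<in> space (cobj_space a)" for x using that by simp
    have "I (\<lambda>\<omega>. g (f \<omega>)) = I (\<lambda>\<omega>. g (trunc a n (f \<omega>)))"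
      by (rule cong[OF gf gt]) (simp add: eq fS)
    then show ?thesis using step[of n] eq[OF barycentre_in_space] by simp
  next
    case Null_seqs
    \<comment> \<open>The truncation errors are a pointwise null sequence of maps into I. Their
      means tend to 0 and bound the differences of the means.\<close>
    let ?d = "\<lambda>k \<omega>. \<bar>g (trunc a k (f \<omega>)) - g (f \<omega>)\<bar>"
    have "(\<lambda>k. I (?d k)) \<longlonglongrightarrow> 0"
    proof (rule null_continuousD[OF null[OF Null_seqs] abs_diff_le(1)[OF gt gf]])
      show "(\<lambda>k. ?d k \<omega>) \<longlonglongrightarrow> 0" if "\<omega> \<in> space \<Omega>" for \<omega>
        using affine_functional_trunc_LIMSEQ[OF g Null_seqs fS[OF that]]
        by (intro tendsto_rabs_zero) (rule Lim_null[THEN iffD1])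
    qed
    then have "(\<lambda>k. I (\<lambda>\<omega>. g (trunc a k (f \<omega>))) - I (\<lambda>\<omega>. g (f \<omega>))) \<longlonglongrightarrow> 0"
      by (rule tendsto_0_le[where K = 1])
         (use abs_diff_le(2)[OF gt gf] in \<open>auto intro!: always_eventually order_trans[OF _ abs_ge_self]\<close>)
    then have "(\<lambda>k. g (trunc a k ?b)) \<longlonglongrightarrow> I (\<lambda>\<omega>. g (f \<omega>))"
      unfolding step by (rule Lim_null[THEN iffD2])
    then show ?thesis
      by (rule LIMSEQ_unique[OF _ affine_functional_trunc_LIMSEQ[OF g Null_seqs barycentre_in_space]])
  qed
qed

end

end

section \<open>Points of the codensity monads as means\<close>

definition coord_map :: "'a measure \<Rightarrow> ('a \<Rightarrow> real) \<Rightarrow> 'a \<Rightarrow> nat \<Rightarrow> real" where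
  "coord_map \<Omega> f = (\<lambda>\<omega>\<in>space \<Omega>. \<lambda>i\<in>{..<1}. f \<omega>)"

lemma char_map_eq_coord_map: "char_map \<Omega> A = coord_map \<Omega> (indicator A)"
  by (simp add: char_map_def coord_map_def)

lemma coord_map_cong: "(\<And>\<omega>. \<omega> \<in> space \<Omega> \<Longrightarrow> f \<omega> = g \<omega>) \<Longrightarrow> coord_map \<Omega> f = coord_map \<Omega> g"
  by (auto simp: coord_map_def)

lemma coord_map_hom:
  assumes "f \<in> unit_functions \<Omega>"
  shows "coord_map \<Omega> f \<in> meas_hom \<Omega> (cobj_space (Cube 1))"
  unfolding coord_map_def
  by (rule meas_hom_restrict, rule measurable_into_cobj_space)
     (use unit_functionsD[OF assms] in \<open>auto simp: in_space_cobj_space_iff\<close>)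

text \<open>The evaluation of the end at f as a real number, after identifying I with
  \<open>Cube 1\<close>.\<close>

definition ev_mean :: "'a measure \<Rightarrow> (cobj \<times> ('a \<Rightarrow> nat \<Rightarrow> real) \<Rightarrow> nat \<Rightarrow> real) \<Rightarrow> ('a \<Rightarrow> real) \<Rightarrow> real" where
  "ev_mean \<Omega> t f = t (Cube 1, coord_map \<Omega> f) 0"

text \<open>The candidate inverse of \<open>ev_mean\<close>. For suitable \<open>I\<close> it
  satisfies the naturality condition of the end by \<open>barycentre_natural\<close>.\<close>

definition mean_point ::
    "(cobj, nat \<Rightarrow> real) concrete_functor \<Rightarrow> 'a measure \<Rightarrow> (('a \<Rightarrow> real) \<Rightarrow> real) \<Rightarrow>
     (cobj \<times> ('a \<Rightarrow> nat \<Rightarrow> real) \<Rightarrow> nat \<Rightarrow> real)" where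
  "mean_point W \<Omega> I = (\<lambda>(a, f)\<in>codensity_index W \<Omega>. barycentre I a f)"

text \<open>Treats both forgetful functors at once; they differ in whether \<open>Null_seqs\<close>
  is an object.\<close>

locale cobj_functor =
  fixes W :: "(cobj, nat \<Rightarrow> real) concrete_functor"
  assumes Und: "Und W = cobj_space" and Arr: "Arr W = affine_maps" and Cube_Obj: "Cube n \<in> Obj W"
begin

context
  fixes \<Omega> :: "'a measure" and t :: "cobj \<times> ('a \<Rightarrow> nat \<Rightarrow> real) \<Rightarrow> nat \<Rightarrow> real"
  assumes t: "t \<in> space (codensity W \<Omega>)"
begin

text \<open>This is naturality of t along g, regarded as a morphism into
  \<open>Cube 1\<close>.\<close>

lemma ev_mean_affine_functional:
  assumes a: "a \<in> Obj W" and f: "f \<in> meas_hom \<Omega> (cobj_space a)" and g: "affine_functional a g"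
  shows "ev_mean \<Omega> t (\<lambda>\<omega>. g (f \<omega>)) = g (t (a, f))"
proof -
  let ?h = "\<lambda>x. \<lambda>i\<in>{..<1}. g x"
  have "t (Cube 1, compose (space \<Omega>) ?h f) = ?h (t (a, f))"
    using t a f Cube_Obj[of 1] affine_functional_map[OF g]
    unfolding space_codensity Und Arr by blast
  moreover have "compose (space \<Omega>) ?h f = coord_map \<Omega> (\<lambda>\<omega>. g (f \<omega>))"
    by (simp add: compose_def coord_map_def)
  ultimately show ?thesis by (simp add: ev_mean_def)
qed

lemma codensity_in_cobj_space:
  "a \<in> Obj W \<Longrightarrow> f \<in> meas_hom \<Omega> (cobj_space a) \<Longrightarrow> t (a, f) \<in> space (cobj_space a)"
  using t by (simp add: space_codensity Und)

lemma codensity_component: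
  assumes a: "a \<in> Obj W" and f: "f \<in> meas_hom \<Omega> (cobj_space a)" and i: "i \<in> dims a"
  shows "t (a, f) i = ev_mean \<Omega> t (\<lambda>\<omega>. f \<omega> i)"
proof -
  have "affine_functional a (\<lambda>x. x i)"
    using i by (auto simp: affine_functional_def in_space_cobj_space_iff)
  from ev_mean_affine_functional[OF a f this] show ?thesis by simp
qed

lemma codensity_eq_barycentre:
  assumes a: "a \<in> Obj W" and f: "f \<in> meas_hom \<Omega> (cobj_space a)"
  shows "t (a, f) = barycentre (ev_mean \<Omega> t) a f"
proof (rule extensionalityI[of _ "dims a"])
  show "t (a, f) \<in> extensional (dims a)"
    using codensity_in_cobj_space[OF a f] by (simp add: in_space_cobj_space_iff)
qed (simp_all add: barycentre_def codensity_component[OF a f])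

text \<open>Coordinate projections are affine, so t is recovered from its action on maps into I.
  This yields the left inverse in \<open>meas_iso_codensity\<close>.\<close>

lemma codensity_eq_mean_point: "t = mean_point W \<Omega> (ev_mean \<Omega> t)"
proof (rule extensionalityI[of _ "codensity_index W \<Omega>"])
  show "t \<in> extensional (codensity_index W \<Omega>)" using t by (simp add: space_codensity)
qed (auto simp: mean_point_def codensity_index_def Und codensity_eq_barycentre)

lemma mean_ev_mean: "mean \<Omega> (ev_mean \<Omega> t)"
proof
  \<comment> \<open>Naturality along affine self-maps of I; constants and scalings then give
    normalisation and homogeneity.\<close>
  have 1: "ev_mean \<Omega> t (\<lambda>\<omega>. g (f \<omega>)) = g (ev_mean \<Omega> t f)"
    if f: "f \<in> unit_functions \<Omega>" and g: "affine_functional (Cube 1) (\<lambda>x. g (x 0))" for f g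
  proof -
    have "ev_mean \<Omega> t (\<lambda>\<omega>. g (coord_map \<Omega> f \<omega> 0)) = g (t (Cube 1, coord_map \<Omega> f) 0)"
      by (rule ev_mean_affine_functional[OF Cube_Obj coord_map_hom[OF f] g])
    moreover have "coord_map \<Omega> (\<lambda>\<omega>. g (coord_map \<Omega> f \<omega> 0)) = coord_map \<Omega> (\<lambda>\<omega>. g (f \<omega>))"
      by (rule coord_map_cong) (simp add: coord_map_def)
    ultimately show ?thesis by (simp add: ev_mean_def)
  qed
  show cong: "ev_mean \<Omega> t f = ev_mean \<Omega> t g" if "\<And>\<omega>. \<omega> \<in> space \<Omega> \<Longrightarrow> f \<omega> = g \<omega>" for f g
    unfolding ev_mean_def by (simp only: coord_map_cong[OF that])
  show "0 \<le> ev_mean \<Omega> t f" if "f \<in> unit_functions \<Omega>" for f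
    using codensity_in_cobj_space[OF Cube_Obj coord_map_hom[OF that]]
    by (simp add: ev_mean_def in_space_cobj_space_iff)
  \<comment> \<open>The sum of two coordinates may leave I, so half of it is used; homogeneity with
    factor 1/2 later undoes the halving.\<close>
  have half: "affine_functional (Cube 2) (\<lambda>x. (x 0 + x 1) / 2)"
    unfolding affine_functional_def
  proof (intro conjI ballI)
    fix x assume "x \<in> space (cobj_space (Cube 2))"
    then have "0 \<le> x 0 \<and> x 0 \<le> 1" "0 \<le> x 1 \<and> x 1 \<le> 1" by (simp_all add: in_space_cobj_space_iff)
    then show "0 \<le> (x 0 + x 1) / 2" "(x 0 + x 1) / 2 \<le> 1" by simp_all
  qed (simp add: field_simps)
  have scale1: "affine_functional (Cube 1) (\<lambda>x. c * x 0)" if "c \<in> {0..1}" for c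
    using that by (auto simp: affine_functional_def in_space_cobj_space_iff algebra_simps mult_le_one)
  show "ev_mean \<Omega> t (\<lambda>_. 1) = 1"
    using 1[of "\<lambda>_. 1" "\<lambda>_. 1"] by (simp add: affine_functional_def const_unit_function)
  show scale: "ev_mean \<Omega> t (\<lambda>\<omega>. c * f \<omega>) = c * ev_mean \<Omega> t f"
    if "f \<in> unit_functions \<Omega>" "c \<in> {0..1}" for c f
    using 1[OF that(1) scale1[OF that(2)]] .
  fix f g assume fg: "f \<in> unit_functions \<Omega>" "g \<in> unit_functions \<Omega>" "(\<lambda>\<omega>. f \<omega> + g \<omega>) \<in> unit_functions \<Omega>"
  \<comment> \<open>The pair of f and g as one map into the square, on which naturality along the
    halved sum can act.\<close>
  define p where "p = (\<lambda>\<omega>\<in>space \<Omega>. \<lambda>i\<in>{..<2::nat}. if i = 0 then f \<omega> else g \<omega>)"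
  have p01: "p \<omega> 0 = f \<omega>" "p \<omega> 1 = g \<omega>" if "\<omega> \<in> space \<Omega>" for \<omega>
    using that by (simp_all add: p_def)
  have p: "p \<in> meas_hom \<Omega> (cobj_space (Cube 2))"
    unfolding p_def
  proof (rule meas_hom_restrict, rule measurable_into_cobj_space)
    show "(\<lambda>\<omega>. (\<lambda>i\<in>{..<2::nat}. if i = 0 then f \<omega> else g \<omega>) i) \<in> borel_measurable \<Omega>"
      if "i \<in> dims (Cube 2)" for i
      using that unit_functionsD(1)[OF fg(1)] unit_functionsD(1)[OF fg(2)] by (cases "i = 0") auto
  qed (use unit_functionsD(2,3)[OF fg(1)] unit_functionsD(2,3)[OF fg(2)] in
      \<open>auto simp: in_space_cobj_space_iff\<close>)
  have "1 / 2 * ev_mean \<Omega> t (\<lambda>\<omega>. f \<omega> + g \<omega>) = ev_mean \<Omega> t (\<lambda>\<omega>. 1 / 2 * (f \<omega> + g \<omega>))"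
    by (rule scale[OF fg(3), symmetric]) simp
  also have "\<dots> = ev_mean \<Omega> t (\<lambda>\<omega>. (p \<omega> 0 + p \<omega> 1) / 2)"
    by (rule cong) (simp add: p01 del: One_nat_def)
  also have "\<dots> = (t (Cube 2, p) 0 + t (Cube 2, p) 1) / 2"
    by (rule ev_mean_affine_functional[OF Cube_Obj p half])
  also have "t (Cube 2, p) 0 = ev_mean \<Omega> t (\<lambda>\<omega>. p \<omega> 0)"
    by (rule codensity_component[OF Cube_Obj p]) simp
  also have "\<dots> = ev_mean \<Omega> t f" by (rule cong) (rule p01)
  also have "t (Cube 2, p) 1 = ev_mean \<Omega> t (\<lambda>\<omega>. p \<omega> 1)"
    by (rule codensity_component[OF Cube_Obj p]) simp
  also have "\<dots> = ev_mean \<Omega> t g" by (rule cong) (rule p01)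
  finally show "ev_mean \<Omega> t (\<lambda>\<omega>. f \<omega> + g \<omega>) = ev_mean \<Omega> t f + ev_mean \<Omega> t g" by simp
qed

end

section \<open>Passing from means back to points of the codensity monad\<close>

lemma barycentre_natural:
  assumes m: "mean \<Omega> I" and null: "a = Null_seqs \<Longrightarrow> null_continuous \<Omega> I"
    and f: "f \<in> meas_hom \<Omega> (cobj_space a)" and h: "h \<in> affine_maps a b"
  shows "barycentre I b (compose (space \<Omega>) h f) = h (barycentre I a f)"
proof -
  interpret mean \<Omega> I by (rule m)
  note fm = meas_hom_measurable[OF f]
  note bS = barycentre_in_space[OF fm null]
  show ?thesis
  proof (rule extensionalityI[of _ "dims b"])
    show "h (barycentre I a f) \<in> extensional (dims b)"
      using h bS by (auto simp: affine_maps_def in_space_cobj_space_iff[of _ b])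
    fix i assume i: "i \<in> dims b"
    note hm = affine_maps_measurable[OF h]
    have "I (\<lambda>\<omega>. compose (space \<Omega>) h f \<omega> i) = I (\<lambda>\<omega>. h (f \<omega>) i)"
      by (rule cong)
         (use component_comp_unit_function[OF meas_hom_measurable[OF meas_hom_compose[OF f hm]] i]
           component_comp_unit_function[OF measurable_compose[OF fm hm] i] in \<open>simp_all add: compose_def\<close>)
    \<comment> \<open>Each coordinate of the affine map h is an affine functional, and those commute
      with the mean.\<close>
    also have "\<dots> = h (barycentre I a f) i"
      by (rule affine_functional_barycentre[OF fm null affine_map_component[OF h i]])
    finally show "barycentre I b (compose (space \<Omega>) h f) i = h (barycentre I a f) i"
      using i by (simp add: barycentre_def)
  qed (simp add: barycentre_def)
qed

text \<open>A common criterion for both monads, with \<open>J\<close> as integration. The inverse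
  sends \<open>\<pi>\<close> to the barycentres of \<open>J \<pi>\<close>, and all comparisons
  reduce to indicators, where the hypotheses apply.\<close>

lemma meas_iso_codensity:
  fixes \<Omega> :: "'a measure" and X :: "'x measure"
  assumes \<theta>: "\<theta> \<in> codensity W \<Omega> \<rightarrow>\<^sub>M X"
    and m: "\<And>\<pi>. \<pi> \<in> space X \<Longrightarrow> mean \<Omega> (J \<pi>)"
    and null: "\<And>\<pi>. Null_seqs \<in> Obj W \<Longrightarrow> \<pi> \<in> space X \<Longrightarrow> null_continuous \<Omega> (J \<pi>)"
    and meas: "\<And>A. A \<in> sets \<Omega> \<Longrightarrow> (\<lambda>\<pi>. J \<pi> (indicator A)) \<in> borel_measurable X"
    and \<theta>_ind: "\<And>t A. t \<in> space (codensity W \<Omega>) \<Longrightarrow> A \<in> sets \<Omega> \<Longrightarrow>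
      J (\<theta> t) (indicator A) = ev_mean \<Omega> t (indicator A)"
    and inj: "\<And>\<pi> \<pi>'. \<pi> \<in> space X \<Longrightarrow> \<pi>' \<in> space X \<Longrightarrow>
      (\<And>A. A \<in> sets \<Omega> \<Longrightarrow> J \<pi> (indicator A) = J \<pi>' (indicator A)) \<Longrightarrow> \<pi> = \<pi>'"
  shows "meas_iso (codensity W \<Omega>) X \<theta>"
proof -
  let ?\<theta>' = "\<lambda>\<pi>\<in>space X. mean_point W \<Omega> (J \<pi>)"
  \<comment> \<open>For general f the mean is a pointwise limit in \<open>\<pi>\<close> of finite
    averages over indicators, whose measurability is assumed.\<close>
  have Jmeas: "(\<lambda>\<pi>. J \<pi> f) \<in> borel_measurable X" if f: "f \<in> unit_functions \<Omega>" for f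
  proof (rule borel_measurable_LIMSEQ_real)
    show "(\<lambda>n. (\<Sum>k<n. J \<pi> (indicator (upper_level \<Omega> f n k))) / n) \<longlonglongrightarrow> J \<pi> f" if "\<pi> \<in> space X" for \<pi>
      by (rule mean.LIMSEQ_upper_levels[OF m[OF that] f])
    show "(\<lambda>\<pi>. (\<Sum>k<n. J \<pi> (indicator (upper_level \<Omega> f n k))) / n) \<in> borel_measurable X" for n
      by (intro borel_measurable_divide borel_measurable_sum meas upper_level_sets unit_functionsD(1)[OF f])
         simp
  qed
  have \<theta>': "?\<theta>' \<in> X \<rightarrow>\<^sub>M codensity W \<Omega>"
    unfolding mean_point_def
  proof (rule meas_hom_measurable, rule codensity_factor)
    fix a f assume a: "a \<in> Obj W" and "f \<in> meas_hom \<Omega> (Und W a)"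
    then have f: "f \<in> meas_hom \<Omega> (cobj_space a)" by (simp add: Und)
    note fm = meas_hom_measurable[OF f]
    have nl: "null_continuous \<Omega> (J \<pi>)" if "a = Null_seqs" "\<pi> \<in> space X" for \<pi>
      using null that a by simp
    show "(\<lambda>\<pi>. barycentre (J \<pi>) a f) \<in> X \<rightarrow>\<^sub>M Und W a"
      unfolding Und
    proof (rule measurable_into_cobj_space)
      show "barycentre (J \<pi>) a f \<in> space (cobj_space a)" if "\<pi> \<in> space X" for \<pi>
        by (rule mean.barycentre_in_space[OF m[OF that] fm nl[OF _ that]])
      show "(\<lambda>\<pi>. barycentre (J \<pi>) a f i) \<in> borel_measurable X" if "i \<in> dims a" for i
        using Jmeas[OF component_comp_unit_function[OF fm that]] that by (simp add: barycentre_def)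
    qed
    show "barycentre (J \<pi>) b (compose (space \<Omega>) h f) = h (barycentre (J \<pi>) a f)"
      if "h \<in> Arr W a b" "\<pi> \<in> space X" for b h \<pi>
      by (rule barycentre_natural[OF m[OF that(2)] nl[OF _ that(2)] f that(1)[unfolded Arr]])
  next
    show "h \<in> Und W a \<rightarrow>\<^sub>M Und W b" if "h \<in> Arr W a b" for a b h
      using that by (simp add: Und Arr affine_maps_measurable)
  qed
  \<comment> \<open>Both sides are means in f, so agreement on indicators extends to all maps into
    I.\<close>
  have J\<theta>: "J (\<theta> t) f = ev_mean \<Omega> t f"
    if "t \<in> space (codensity W \<Omega>)" "f \<in> unit_functions \<Omega>" for t f
    by (rule mean.eqI_indicator[OF m[OF measurable_space[OF \<theta> that(1)]]
          mean_ev_mean[OF that(1)] \<theta>_ind[OF that(1)] that(2)])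
  have left: "?\<theta>' (\<theta> t) = t" if t: "t \<in> space (codensity W \<Omega>)" for t
  proof -
    have "barycentre (J (\<theta> t)) a f = barycentre (ev_mean \<Omega> t) a f"
      if "f \<in> meas_hom \<Omega> (cobj_space a)" for a f
      unfolding barycentre_def
      by (rule restrict_ext)
         (rule J\<theta>[OF t component_comp_unit_function[OF meas_hom_measurable[OF that]]])
    then have "mean_point W \<Omega> (J (\<theta> t)) = mean_point W \<Omega> (ev_mean \<Omega> t)"
      unfolding mean_point_def by (intro restrict_ext) (auto simp: codensity_index_def Und)
    then show ?thesis
      using measurable_space[OF \<theta> t] codensity_eq_mean_point[OF t] by simp
  qed
  have right: "\<theta> (?\<theta>' \<pi>) = \<pi>" if \<pi>: "\<pi> \<in> space X" for \<pi>
  proof (rule inj)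
    have t: "mean_point W \<Omega> (J \<pi>) \<in> space (codensity W \<Omega>)"
      using measurable_space[OF \<theta>' \<pi>] \<pi> by simp
    then show "\<theta> (?\<theta>' \<pi>) \<in> space X"
      using measurable_space[OF \<theta>] \<pi> by simp
    fix A assume A: "A \<in> sets \<Omega>"
    note u = indicator_unit_function[OF A]
    have "J (\<theta> (?\<theta>' \<pi>)) (indicator A) = mean_point W \<Omega> (J \<pi>) (Cube 1, coord_map \<Omega> (indicator A)) 0"
      using \<theta>_ind[OF t A] \<pi> by (simp add: ev_mean_def)
    also have "\<dots> = J \<pi> (\<lambda>\<omega>. coord_map \<Omega> (indicator A) \<omega> 0)"
      using coord_map_hom[OF u] Cube_Obj[of 1]
      by (simp add: mean_point_def codensity_index_def Und barycentre_def)
    also have "\<dots> = J \<pi> (indicator A)"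
      using component_comp_unit_function[OF meas_hom_measurable[OF coord_map_hom[OF u]], of 0]
      by (intro mean.cong[OF m[OF \<pi>]] u) (simp_all add: coord_map_def)
    finally show "J (\<theta> (?\<theta>' \<pi>)) (indicator A) = J \<pi> (indicator A)" .
  qed (rule \<pi>)
  show ?thesis unfolding meas_iso_def using \<theta> \<theta>' left right by blast
qed

section \<open>The monad structure expressed through means\<close>

lemma ev_mean_unit_function:
  assumes "f \<in> unit_functions \<Omega>"
  shows "(\<lambda>t. ev_mean \<Omega> t f) \<in> unit_functions (codensity W \<Omega>)"
proof -
  have "coord_map \<Omega> f \<in> meas_hom \<Omega> (Und W (Cube 1))" using coord_map_hom[OF assms] by (simp add: Und)
  from meas_hom_measurable[OF codensity_ev_hom[OF Cube_Obj this], unfolded Und]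
  have "(\<lambda>t. t (Cube 1, coord_map \<Omega> f)) \<in> codensity W \<Omega> \<rightarrow>\<^sub>M cobj_space (Cube 1)"
    by (simp add: codensity_ev_def cong: measurable_cong)
  from unit_function_compose[OF component_unit_function this, of 0]
  show ?thesis by (simp add: ev_mean_def)
qed

lemma ev_mean_map:
  assumes g: "g \<in> meas_hom \<Omega> \<Omega>'" and t: "t \<in> space (codensity W \<Omega>)" and f: "f \<in> unit_functions \<Omega>'"
  shows "ev_mean \<Omega>' (codensity_map W \<Omega> \<Omega>' g t) f = ev_mean \<Omega> t (\<lambda>\<omega>. f (g \<omega>))"
proof -
  have "compose (space \<Omega>) (coord_map \<Omega>' f) g = coord_map \<Omega> (\<lambda>\<omega>. f (g \<omega>))"
    using meas_hom_space[OF g] by (auto simp: compose_def coord_map_def)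
  then show ?thesis
    using t coord_map_hom[OF f] Cube_Obj[of 1]
    by (simp add: ev_mean_def codensity_map_def codensity_index_def Und)
qed

lemma ev_mean_unit:
  assumes "\<omega> \<in> space \<Omega>" "f \<in> unit_functions \<Omega>"
  shows "ev_mean \<Omega> (codensity_unit W \<Omega> \<omega>) f = f \<omega>"
  using assms coord_map_hom[OF assms(2)] Cube_Obj[of 1]
  by (simp add: ev_mean_def codensity_unit_def codensity_index_def Und)
     (simp add: coord_map_def)

lemma ev_mean_mult:
  assumes \<rho>: "\<rho> \<in> space (codensity W (codensity W \<Omega>))" and f: "f \<in> unit_functions \<Omega>"
  shows "ev_mean \<Omega> (codensity_mult W \<Omega> \<rho>) f = ev_mean (codensity W \<Omega>) \<rho> (\<lambda>t. ev_mean \<Omega> t f)"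
proof -
  let ?T = "codensity W \<Omega>"
  \<comment> \<open>Evaluation at \<open>coord_map \<Omega> f\<close> is itself a coordinate map,
    namely that of \<open>ev_mean \<Omega> t f\<close> as a function of t. Off coordinate 0 both are
    \<open>undefined\<close>.\<close>
  have "codensity_ev W \<Omega> (Cube 1) (coord_map \<Omega> f) = coord_map ?T (\<lambda>t. ev_mean \<Omega> t f)"
    unfolding codensity_ev_def coord_map_def[of ?T]
  proof (rule restrict_ext)
    fix t assume "t \<in> space ?T"
    from codensity_in_cobj_space[OF this Cube_Obj coord_map_hom[OF f]]
    have "t (Cube 1, coord_map \<Omega> f) \<in> extensional {..<1}" by (simp add: in_space_cobj_space_iff)
    then show "t (Cube 1, coord_map \<Omega> f) = (\<lambda>i\<in>{..<1}. ev_mean \<Omega> t f)"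
      by (auto simp: ev_mean_def fun_eq_iff extensional_def)
  qed
  moreover have "codensity_mult W \<Omega> \<rho> (Cube 1, coord_map \<Omega> f) =
      \<rho> (Cube 1, codensity_ev W \<Omega> (Cube 1) (coord_map \<Omega> f))"
    using \<rho> coord_map_hom[OF f] Cube_Obj[of 1]
    by (simp add: codensity_mult_def codensity_index_def Und)
  ultimately show ?thesis
    by (simp only: ev_mean_def[of \<Omega> "codensity_mult W \<Omega> \<rho>"] ev_mean_def[of ?T])
qed

lemma codensity_map_in_space:
  assumes "g \<in> meas_hom \<Omega> \<Omega>'" "t \<in> space (codensity W \<Omega>)"
  shows "codensity_map W \<Omega> \<Omega>' g t \<in> space (codensity W \<Omega>')"
  by (rule meas_hom_space[OF codensity_map_hom[OF _ assms(1)] assms(2)])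
     (simp add: Und Arr affine_maps_measurable)

lemma codensity_unit_in_space:
  assumes "\<omega> \<in> space \<Omega>"
  shows "codensity_unit W \<Omega> \<omega> \<in> space (codensity W \<Omega>)"
  by (rule meas_hom_space[OF codensity_unit_hom assms]) (simp add: Und Arr affine_maps_measurable)

lemma codensity_mult_in_space:
  assumes "\<rho> \<in> space (codensity W (codensity W \<Omega>))"
  shows "codensity_mult W \<Omega> \<rho> \<in> space (codensity W \<Omega>)"
  by (rule meas_hom_space[OF codensity_mult_hom assms]) (simp add: Und Arr affine_maps_measurable)

end

interpretation U: cobj_functor functor_U
  by standard (simp_all add: functor_U_def)

interpretation V: cobj_functor functor_V
  by standard (simp_all add: functor_V_def)

section \<open>The finitely additive Giry monad\<close>

lemma fin_giry_generators: "{{\<pi> \<in> fin_add_probs \<Omega>. \<pi> A \<in> B} | A B. A \<in> sets \<Omega> \<and> B \<in> sets borel} \<subseteq> Pow (fin_add_probs \<Omega>)"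
  by auto

lemma space_fin_giry: "space (fin_giry \<Omega>) = fin_add_probs \<Omega>"
  unfolding fin_giry_def by (rule space_measure_of[OF fin_giry_generators])

lemma fin_giry_eval_measurable:
  assumes "A \<in> sets \<Omega>"
  shows "(\<lambda>\<pi>. \<pi> A) \<in> borel_measurable (fin_giry \<Omega>)"
proof (rule measurableI)
  fix B :: "real set" assume "B \<in> sets borel"
  then have "{\<pi> \<in> fin_add_probs \<Omega>. \<pi> A \<in> B} \<in> sets (fin_giry \<Omega>)"
    unfolding fin_giry_def sets_measure_of[OF fin_giry_generators] using assms by blast
  then show "(\<lambda>\<pi>. \<pi> A) -` B \<inter> space (fin_giry \<Omega>) \<in> sets (fin_giry \<Omega>)"
    by (simp add: space_fin_giry vimage_def Int_def conj_commute)
qed simp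

lemma measurable_fin_giryI:
  assumes "\<And>x. x \<in> space X \<Longrightarrow> h x \<in> fin_add_probs \<Omega>"
    and "\<And>A. A \<in> sets \<Omega> \<Longrightarrow> (\<lambda>x. h x A) \<in> borel_measurable X"
  shows "h \<in> X \<rightarrow>\<^sub>M fin_giry \<Omega>"
  unfolding fin_giry_def
proof (rule measurable_measure_of[OF fin_giry_generators])
  show "h \<in> space X \<rightarrow> fin_add_probs \<Omega>" using assms(1) by blast
  fix Y assume "Y \<in> {{\<pi> \<in> fin_add_probs \<Omega>. \<pi> A \<in> B} | A B. A \<in> sets \<Omega> \<and> B \<in> sets borel}"
  then obtain A B where Y: "Y = {\<pi> \<in> fin_add_probs \<Omega>. \<pi> A \<in> B}" "A \<in> sets \<Omega>" "B \<in> sets borel" by blast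
  have "h -` Y \<inter> space X = (\<lambda>x. h x A) -` B \<inter> space X" using assms(1) Y(1) by auto
  with measurable_sets[OF assms(2)[OF Y(2)] Y(3)] show "h -` Y \<inter> space X \<in> sets X" by simp
qed

lemma to_fin_giry_eq: "to_fin_giry \<Omega> t = (\<lambda>A\<in>sets \<Omega>. ev_mean \<Omega> t (indicator A))"
  by (simp add: to_fin_giry_def ev_mean_def char_map_eq_coord_map)

lemma fin_add_probs_ext:
  assumes "\<pi> \<in> fin_add_probs \<Omega>" "\<pi>' \<in> fin_add_probs \<Omega>" "\<And>A. A \<in> sets \<Omega> \<Longrightarrow> \<pi> A = \<pi>' A"
  shows "\<pi> = \<pi>'"
  using assms by (auto simp: fin_add_probs_def intro: PiE_ext)

lemma to_fin_giry_in_space: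
  "t \<in> space (codensity functor_U \<Omega>) \<Longrightarrow> to_fin_giry \<Omega> t \<in> fin_add_probs \<Omega>"
  unfolding to_fin_giry_eq by (rule mean.fin_add_prob[OF U.mean_ev_mean])

lemma to_fin_giry_measurable: "to_fin_giry \<Omega> \<in> codensity functor_U \<Omega> \<rightarrow>\<^sub>M fin_giry \<Omega>"
proof (rule measurable_fin_giryI[OF to_fin_giry_in_space])
  show "(\<lambda>t. to_fin_giry \<Omega> t A) \<in> borel_measurable (codensity functor_U \<Omega>)" if "A \<in> sets \<Omega>" for A
    using that unit_functionsD(1)[OF U.ev_mean_unit_function[OF indicator_unit_function[OF that]]]
    by (simp add: to_fin_giry_eq)
qed

lemma to_fin_giry_iso: "meas_iso (codensity functor_U \<Omega>) (fin_giry \<Omega>) (to_fin_giry \<Omega>)"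
proof (rule U.meas_iso_codensity[OF to_fin_giry_measurable, where J = "fin_add_integral \<Omega>"])
  show "mean \<Omega> (fin_add_integral \<Omega> \<pi>)" if "\<pi> \<in> space (fin_giry \<Omega>)" for \<pi>
    using that by (simp add: space_fin_giry mean_fin_add_integral)
  \<comment> \<open>Vacuous, because d_0 is not an object of the domain of U.\<close>
  show "null_continuous \<Omega> (fin_add_integral \<Omega> \<pi>)" if "Null_seqs \<in> Obj functor_U" for \<pi>
    using that by (auto simp: functor_U_def)
  show "(\<lambda>\<pi>. fin_add_integral \<Omega> \<pi> (indicator A)) \<in> borel_measurable (fin_giry \<Omega>)"
    if "A \<in> sets \<Omega>" for A
    by (rule measurable_cong[THEN iffD2, OF _ fin_giry_eval_measurable[OF that]])
       (simp add: fin_add_integral_indicator space_fin_giry that)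
  show "fin_add_integral \<Omega> (to_fin_giry \<Omega> t) (indicator A) = ev_mean \<Omega> t (indicator A)"
    if "t \<in> space (codensity functor_U \<Omega>)" "A \<in> sets \<Omega>" for t A
    using fin_add_integral_indicator[OF to_fin_giry_in_space[OF that(1)] that(2)] that(2)
    by (simp add: to_fin_giry_eq)
  show "\<pi> = \<pi>'"
    if "\<pi> \<in> space (fin_giry \<Omega>)" "\<pi>' \<in> space (fin_giry \<Omega>)"
      "\<And>A. A \<in> sets \<Omega> \<Longrightarrow> fin_add_integral \<Omega> \<pi> (indicator A) = fin_add_integral \<Omega> \<pi>' (indicator A)"
    for \<pi> \<pi>'
    using that by (intro fin_add_probs_ext[of \<pi> \<Omega>]) (auto simp: space_fin_giry fin_add_integral_indicator)
qed

lemma to_fin_giry_natural: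
  assumes g: "g \<in> meas_hom \<Omega> \<Omega>'" and t: "t \<in> space (codensity functor_U \<Omega>)"
  shows "to_fin_giry \<Omega>' (codensity_map functor_U \<Omega> \<Omega>' g t) =
    fin_giry_map \<Omega> \<Omega>' g (to_fin_giry \<Omega> t)"
  unfolding to_fin_giry_eq fin_giry_map_def
proof (rule restrict_ext)
  interpret mean \<Omega> "ev_mean \<Omega> t" by (rule U.mean_ev_mean[OF t])
  fix A assume A: "A \<in> sets \<Omega>'"
  note gm = meas_hom_measurable[OF g]
  show "ev_mean \<Omega>' (codensity_map functor_U \<Omega> \<Omega>' g t) (indicator A) =
      (\<lambda>A\<in>sets \<Omega>. ev_mean \<Omega> t (indicator A)) (g -` A \<inter> space \<Omega>)"
    using measurable_sets[OF gm A]
    by (simp add: U.ev_mean_map[OF g t indicator_unit_function[OF A]] indicator_vimage[OF gm A])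
qed

lemma to_fin_giry_unit:
  "\<omega> \<in> space \<Omega> \<Longrightarrow> to_fin_giry \<Omega> (codensity_unit functor_U \<Omega> \<omega>) = fin_giry_unit \<Omega> \<omega>"
  unfolding to_fin_giry_eq fin_giry_unit_def
  by (rule restrict_ext) (rule U.ev_mean_unit[OF _ indicator_unit_function])

text \<open>At each A both sides are the mean given by \<rho> of the function
  \<open>\<lambda>t. to_fin_giry \<Omega> t A\<close>. On the right this is the integral
  representation of the push-forward of that mean along the comparison map.\<close>

lemma to_fin_giry_mult:
  assumes \<rho>: "\<rho> \<in> space (codensity functor_U (codensity functor_U \<Omega>))"
  shows "to_fin_giry \<Omega> (codensity_mult functor_U \<Omega> \<rho>) =
    fin_giry_mult \<Omega>
      (fin_giry_map (codensity functor_U \<Omega>) (fin_giry \<Omega>) (to_fin_giry \<Omega>)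
        (to_fin_giry (codensity functor_U \<Omega>) \<rho>))"
proof -
  let ?T = "codensity functor_U \<Omega>"
  let ?\<theta> = "to_fin_giry \<Omega>"
  interpret R: mean ?T "ev_mean ?T \<rho>" by (rule U.mean_ev_mean[OF \<rho>])
  interpret P: mean "fin_giry \<Omega>" "\<lambda>f. ev_mean ?T \<rho> (\<lambda>t. f (?\<theta> t))"
    by (rule R.mean_image[OF to_fin_giry_measurable])
  have push: "fin_giry_map ?T (fin_giry \<Omega>) ?\<theta> (to_fin_giry ?T \<rho>) =
      (\<lambda>A\<in>sets (fin_giry \<Omega>). ev_mean ?T \<rho> (\<lambda>t. indicator A (?\<theta> t)))"
    unfolding fin_giry_map_def
    by (rule restrict_ext)
       (simp add: to_fin_giry_eq[of ?T] measurable_sets[OF to_fin_giry_measurable]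
          R.indicator_vimage[OF to_fin_giry_measurable])
  show ?thesis
    unfolding to_fin_giry_eq[of \<Omega> "codensity_mult functor_U \<Omega> \<rho>"] fin_giry_mult_def push
  proof (rule restrict_ext)
    fix A assume A: "A \<in> sets \<Omega>"
    note u = indicator_unit_function[OF A]
    have v: "(\<lambda>\<pi>. \<pi> A) \<in> unit_functions (fin_giry \<Omega>)"
      by (rule unit_functionsI[OF fin_giry_eval_measurable[OF A]])
         (use A in \<open>auto simp: space_fin_giry fin_add_probs_def\<close>)
    have "ev_mean \<Omega> (codensity_mult functor_U \<Omega> \<rho>) (indicator A) =
        ev_mean ?T \<rho> (\<lambda>t. ev_mean \<Omega> t (indicator A))"
      by (rule U.ev_mean_mult[OF \<rho> u])
    also have "\<dots> = ev_mean ?T \<rho> (\<lambda>t. ?\<theta> t A)"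
      using A by (simp add: to_fin_giry_eq)
    also have "\<dots> = fin_add_integral (fin_giry \<Omega>)
        (\<lambda>A\<in>sets (fin_giry \<Omega>). ev_mean ?T \<rho> (\<lambda>t. indicator A (?\<theta> t))) (\<lambda>\<pi>. \<pi> A)"
      by (rule P.eq_fin_add_integral[OF v])
    finally show "ev_mean \<Omega> (codensity_mult functor_U \<Omega> \<rho>) (indicator A) = \<dots>" .
  qed
qed

section \<open>The Giry monad\<close>

text \<open>Null continuity is dominated convergence with the constant bound 1.\<close>

lemma mean_lebesgue:
  assumes P: "prob_space P" and sets: "sets P = sets \<Omega>"
  shows "mean \<Omega> (integral\<^sup>L P)" and "null_continuous \<Omega> (integral\<^sup>L P)"
proof -
  interpret prob_space P by (rule P)
  have sp: "space P = space \<Omega>" by (rule sets_eq_imp_space_eq[OF sets])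
  have meas: "f \<in> borel_measurable P" if "f \<in> unit_functions \<Omega>" for f
    using unit_functionsD(1)[OF that] by (simp cong: measurable_cong_sets add: sets)
  have int: "integrable P f" if "f \<in> unit_functions \<Omega>" for f
    by (rule integrable_const_bound[where B = 1])
       (use meas[OF that] unit_functionsD(2,3)[OF that] in \<open>auto simp: sp\<close>)
  show "mean \<Omega> (integral\<^sup>L P)"
  proof
    show "integral\<^sup>L P f = integral\<^sup>L P g" if "\<And>\<omega>. \<omega> \<in> space \<Omega> \<Longrightarrow> f \<omega> = g \<omega>" for f g
      by (rule Bochner_Integration.integral_cong) (use that sp in auto)
    show "0 \<le> integral\<^sup>L P f" if "f \<in> unit_functions \<Omega>" for f
      by (rule Bochner_Integration.integral_nonneg) (use unit_functionsD(2)[OF that] sp in auto)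
  qed (simp_all add: int prob_space)
  show "null_continuous \<Omega> (integral\<^sup>L P)"
    unfolding null_continuous_def
  proof (intro allI impI)
    fix f :: "nat \<Rightarrow> 'a \<Rightarrow> real"
    assume f: "\<forall>n. f n \<in> unit_functions \<Omega>" and lim: "\<forall>\<omega>\<in>space \<Omega>. (\<lambda>n. f n \<omega>) \<longlonglongrightarrow> 0"
    have "(\<lambda>n. integral\<^sup>L P (f n)) \<longlonglongrightarrow> integral\<^sup>L P (\<lambda>_. 0)"
      by (rule integral_dominated_convergence[where w = "\<lambda>_. 1"])
         (use f lim meas unit_functionsD(2,3)[of "f _" \<Omega>] in \<open>auto simp: sp\<close>)
    then show "(\<lambda>n. integral\<^sup>L P (f n)) \<longlonglongrightarrow> 0" by simp
  qed
qed

section \<open>Countable additivity from evaluation at maps into d_0\<close>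

lemma ev_mean_decseq:
  assumes t: "t \<in> space (codensity functor_V \<Omega>)"
    and A: "range A \<subseteq> sets \<Omega>" "decseq A" "(\<Inter>i. A i) = {}"
  shows "(\<lambda>i. ev_mean \<Omega> t (indicator (A i))) \<longlonglongrightarrow> 0"
proof -
  \<comment> \<open>Every point eventually leaves the decreasing sets, so the sequence of their
    indicators is a single map into d_0. That t sends it to a point of d_0 is the required
    limit.\<close>
  let ?f = "\<lambda>\<omega>\<in>space \<Omega>. \<lambda>i. indicator (A i) \<omega> :: real"
  have N: "Null_seqs \<in> Obj functor_V" by (simp add: functor_V_def)
  have lim: "(\<lambda>i. indicator (A i) \<omega> :: real) \<longlonglongrightarrow> 0" for \<omega>
    using LIMSEQ_indicator_decseq[OF A(2), of \<omega>] A(3) by simp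
  have f: "?f \<in> meas_hom \<Omega> (cobj_space Null_seqs)"
    by (rule meas_hom_restrict, rule measurable_into_cobj_space)
       (use A(1) lim in \<open>auto simp: in_space_cobj_space_iff indicator_def\<close>)
  have "t (Null_seqs, ?f) \<longlonglongrightarrow> 0"
    using V.codensity_in_cobj_space[OF t N f] by (simp add: in_space_cobj_space_iff)
  moreover have "t (Null_seqs, ?f) = (\<lambda>i. ev_mean \<Omega> t (indicator (A i)))"
  proof
    fix i
    have "t (Null_seqs, ?f) i = ev_mean \<Omega> t (\<lambda>\<omega>. ?f \<omega> i)"
      by (rule V.codensity_component[OF t N f]) simp
    also have "\<dots> = ev_mean \<Omega> t (indicator (A i))"
      unfolding ev_mean_def by (subst coord_map_cong[of _ _ "indicator (A i)"]) simp_all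
    finally show "t (Null_seqs, ?f) i = ev_mean \<Omega> t (indicator (A i))" .
  qed
  ultimately show ?thesis by (simp only:)
qed

lemma sets_to_giry: "sets (to_giry \<Omega> t) = sets \<Omega>"
  and space_to_giry: "space (to_giry \<Omega> t) = space \<Omega>"
  by (simp_all add: to_giry_def)

context
  fixes \<Omega> :: "'a measure" and t :: "cobj \<times> ('a \<Rightarrow> nat \<Rightarrow> real) \<Rightarrow> nat \<Rightarrow> real"
  assumes t: "t \<in> space (codensity functor_V \<Omega>)"
begin

interpretation mean \<Omega> "ev_mean \<Omega> t" by (rule V.mean_ev_mean[OF t])

text \<open>\<open>measure_of\<close> takes the prescribed values once they are known to be
  countably additive. For a finite additive set function this follows from continuity at the empty
  set.\<close>

lemma emeasure_to_giry:
  assumes "A \<in> sets \<Omega>"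
  shows "emeasure (to_giry \<Omega> t) A = ennreal (ev_mean \<Omega> t (indicator A))"
proof -
  let ?m = "\<lambda>A. ennreal (ev_mean \<Omega> t (indicator A))"
  have "indicator {} = (\<lambda>_ :: 'a. 0 :: real)" by auto
  then have pos: "positive (sets \<Omega>) ?m"
    by (simp add: positive_def zero)
  have add: "additive (sets \<Omega>) ?m"
    by (auto simp: additive_def indicator_Un nonneg indicator_unit_function simp flip: ennreal_plus)
  have "countably_additive (sets \<Omega>) ?m"
  proof (rule sets.empty_continuous_imp_countably_additive[OF pos add])
    fix A :: "nat \<Rightarrow> 'a set" assume "range A \<subseteq> sets \<Omega>" "decseq A" "(\<Inter>i. A i) = {}"
    then show "(\<lambda>i. ?m (A i)) \<longlonglongrightarrow> 0"
      using tendsto_ennrealI[OF ev_mean_decseq[OF t]] by simp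
  qed simp
  from emeasure_measure_of_sigma[OF sets.sigma_algebra_axioms pos this assms]
  show ?thesis by (simp add: to_giry_def ev_mean_def char_map_eq_coord_map)
qed

lemma measure_to_giry: "A \<in> sets \<Omega> \<Longrightarrow> measure (to_giry \<Omega> t) A = ev_mean \<Omega> t (indicator A)"
  by (simp add: measure_def emeasure_to_giry nonneg indicator_unit_function)

lemma to_giry_in_space: "to_giry \<Omega> t \<in> space (prob_algebra \<Omega>)"
  by (auto simp: space_prob_algebra sets_to_giry space_to_giry emeasure_to_giry indicator_space
      intro!: prob_spaceI)

text \<open>Both sides are means in f and have equal values on indicators.\<close>

lemma integral_to_giry:
  assumes "f \<in> unit_functions \<Omega>"
  shows "integral\<^sup>L (to_giry \<Omega> t) f = ev_mean \<Omega> t f"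
proof (rule mean.eqI_indicator[OF mean_lebesgue(1) mean_axioms _ assms])
  show "prob_space (to_giry \<Omega> t)" using to_giry_in_space by (simp add: space_prob_algebra)
  show "integral\<^sup>L (to_giry \<Omega> t) (indicator A) = ev_mean \<Omega> t (indicator A)" if "A \<in> sets \<Omega>" for A
    using that sets.sets_into_space[OF that]
    by (simp add: measure_to_giry space_to_giry Int_absorb2)
qed (rule sets_to_giry)

end

lemma to_giry_measurable: "to_giry \<Omega> \<in> codensity functor_V \<Omega> \<rightarrow>\<^sub>M prob_algebra \<Omega>"
proof (rule measurable_prob_algebraI)
  show "prob_space (to_giry \<Omega> t)" if "t \<in> space (codensity functor_V \<Omega>)" for t
    using to_giry_in_space[OF that] by (simp add: space_prob_algebra)
  then show "to_giry \<Omega> \<in> codensity functor_V \<Omega> \<rightarrow>\<^sub>M subprob_algebra \<Omega>"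
  proof (intro measurable_subprob_algebra prob_space_imp_subprob_space sets_to_giry)
    show "(\<lambda>t. emeasure (to_giry \<Omega> t) A) \<in> borel_measurable (codensity functor_V \<Omega>)" if "A \<in> sets \<Omega>" for A
      using unit_functionsD(1)[OF V.ev_mean_unit_function[OF indicator_unit_function[OF that]]]
      by (simp add: emeasure_to_giry that cong: measurable_cong)
  qed
qed

lemma to_giry_iso: "meas_iso (codensity functor_V \<Omega>) (prob_algebra \<Omega>) (to_giry \<Omega>)"
proof (rule V.meas_iso_codensity[OF to_giry_measurable, where J = "\<lambda>P. integral\<^sup>L P"])
  fix P assume "P \<in> space (prob_algebra \<Omega>)"
  then have "prob_space P" "sets P = sets \<Omega>" by (simp_all add: space_prob_algebra)
  then show "mean \<Omega> (integral\<^sup>L P)" "null_continuous \<Omega> (integral\<^sup>L P)" by (rule mean_lebesgue)+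
next
  have ind: "integral\<^sup>L P (indicat_real A) = measure P A"
    if "P \<in> space (prob_algebra \<Omega>)" "A \<in> sets \<Omega>" for P A
  proof -
    have "A \<subseteq> space P"
      using that sets.sets_into_space[of A P] by (simp add: space_prob_algebra)
    then show ?thesis by (simp add: Int_absorb2)
  qed
  show "(\<lambda>P. integral\<^sup>L P (indicat_real A)) \<in> borel_measurable (prob_algebra \<Omega>)" if "A \<in> sets \<Omega>" for A
    by (rule measurable_cong[THEN iffD2, OF _ measurable_measure_prob_algebra[OF that]])
       (rule ind[OF _ that])
  show "P = Q"
    if P: "P \<in> space (prob_algebra \<Omega>)" and Q: "Q \<in> space (prob_algebra \<Omega>)"
      and eq: "\<And>A. A \<in> sets \<Omega> \<Longrightarrow> integral\<^sup>L P (indicat_real A) = integral\<^sup>L Q (indicator A)" for P Q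
  proof (rule measure_eqI)
    interpret P: prob_space P using P by (simp add: space_prob_algebra)
    interpret Q: prob_space Q using Q by (simp add: space_prob_algebra)
    show "sets P = sets Q" using P Q by (simp add: space_prob_algebra)
    show "emeasure P A = emeasure Q A" if "A \<in> sets P" for A
      using eq[of A] that P Q ind[OF P, of A] ind[OF Q, of A]
      by (simp add: P.emeasure_eq_measure Q.emeasure_eq_measure space_prob_algebra)
  qed
qed (rule integral_to_giry[OF _ indicator_unit_function])

lemma to_giry_natural:
  assumes g: "g \<in> meas_hom \<Omega> \<Omega>'" and t: "t \<in> space (codensity functor_V \<Omega>)"
  shows "to_giry \<Omega>' (codensity_map functor_V \<Omega> \<Omega>' g t) = distr (to_giry \<Omega> t) \<Omega>' g"
proof (rule measure_eqI)
  interpret mean \<Omega> "ev_mean \<Omega> t" by (rule V.mean_ev_mean[OF t])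
  note gm = meas_hom_measurable[OF g]
  fix A assume "A \<in> sets (to_giry \<Omega>' (codensity_map functor_V \<Omega> \<Omega>' g t))"
  then have A: "A \<in> sets \<Omega>'" by (simp add: sets_to_giry)
  have gm': "g \<in> to_giry \<Omega> t \<rightarrow>\<^sub>M \<Omega>'" using gm by (simp cong: measurable_cong_sets add: sets_to_giry)
  show "emeasure (to_giry \<Omega>' (codensity_map functor_V \<Omega> \<Omega>' g t)) A =
      emeasure (distr (to_giry \<Omega> t) \<Omega>' g) A"
    using measurable_sets[OF gm A]
    by (simp add: emeasure_distr[OF gm' A] emeasure_to_giry V.codensity_map_in_space g t A space_to_giry
        V.ev_mean_map indicator_unit_function indicator_vimage[OF gm A])
qed (simp add: sets_to_giry)

lemma to_giry_unit:
  assumes "\<omega> \<in> space \<Omega>"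
  shows "to_giry \<Omega> (codensity_unit functor_V \<Omega> \<omega>) = return \<Omega> \<omega>"
proof (rule measure_eqI)
  show "emeasure (to_giry \<Omega> (codensity_unit functor_V \<Omega> \<omega>)) A = emeasure (return \<Omega> \<omega>) A"
    if "A \<in> sets (to_giry \<Omega> (codensity_unit functor_V \<Omega> \<omega>))" for A
    using that assms
    by (simp add: sets_to_giry emeasure_to_giry V.codensity_unit_in_space V.ev_mean_unit
        indicator_unit_function ennreal_indicator)
qed (simp add: sets_to_giry)

text \<open>At each A the right-hand side is rewritten by change of variables along the comparison
  map, then by \<open>integral_to_giry\<close> one level up, and finally by
  \<open>ev_mean_mult\<close>.\<close>

lemma to_giry_mult:
  assumes \<rho>: "\<rho> \<in> space (codensity functor_V (codensity functor_V \<Omega>))"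
  shows "to_giry \<Omega> (codensity_mult functor_V \<Omega> \<rho>) =
    giry_mult (distr (to_giry (codensity functor_V \<Omega>) \<rho>) (prob_algebra \<Omega>) (to_giry \<Omega>))"
proof -
  let ?T = "codensity functor_V \<Omega>"
  let ?R = "to_giry ?T \<rho>"
  let ?D = "distr ?R (prob_algebra \<Omega>) (to_giry \<Omega>)"
  have sR: "sets ?R = sets ?T" "space ?R = space ?T" by (simp_all add: sets_to_giry space_to_giry)
  have m: "to_giry \<Omega> \<in> ?R \<rightarrow>\<^sub>M prob_algebra \<Omega>"
    using to_giry_measurable by (simp cong: measurable_cong_sets add: sR)
  interpret R: prob_space ?R using to_giry_in_space[OF \<rho>] by (simp add: space_prob_algebra)
  have D: "?D \<in> space (prob_algebra (prob_algebra \<Omega>))"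
    using R.prob_space_distr[OF m] by (simp add: space_prob_algebra)
  show ?thesis
  proof (rule measure_eqI)
    show "sets (to_giry \<Omega> (codensity_mult functor_V \<Omega> \<rho>)) = sets (giry_mult ?D)"
      by (simp add: sets_to_giry giry_mult_eq(1)[OF D])
    fix A assume "A \<in> sets (to_giry \<Omega> (codensity_mult functor_V \<Omega> \<rho>))"
    then have A: "A \<in> sets \<Omega>" by (simp add: sets_to_giry)
    note u = indicator_unit_function[OF A]
    note v = V.ev_mean_unit_function[OF u]
    have em: "(\<lambda>\<pi>. emeasure \<pi> A) \<in> borel_measurable (prob_algebra \<Omega>)"
      using A by (intro measurable_emeasure_kernel measurable_prob_algebraD) simp_all
    have "emeasure (giry_mult ?D) A = (\<integral>\<^sup>+ t. emeasure (to_giry \<Omega> t) A \<partial>?R)"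
      unfolding giry_mult_eq(2)[OF D A] by (rule nn_integral_distr[OF m]) (simp add: em)
    also have "\<dots> = (\<integral>\<^sup>+ t. ennreal (ev_mean \<Omega> t (indicator A)) \<partial>?R)"
      by (rule nn_integral_cong) (simp add: sR emeasure_to_giry A)
    \<comment> \<open>The integrand takes values in I on a probability space, so the nonnegative
      integral is a real one, which \<open>integral_to_giry\<close> evaluates.\<close>
    also have "\<dots> = ennreal (integral\<^sup>L ?R (\<lambda>t. ev_mean \<Omega> t (indicator A)))"
    proof (rule nn_integral_eq_integral)
      show "integrable ?R (\<lambda>t. ev_mean \<Omega> t (indicator A))"
        by (rule R.integrable_const_bound[where B = 1])
           (use unit_functionsD[OF v] in \<open>auto simp: sR cong: measurable_cong_sets\<close>)
      show "AE t in ?R. 0 \<le> ev_mean \<Omega> t (indicator A)"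
        by (rule AE_I2, rule unit_functionsD(2)[OF v]) (simp add: sR)
    qed
    also have "\<dots> = ennreal (ev_mean \<Omega> (codensity_mult functor_V \<Omega> \<rho>) (indicator A))"
      by (simp add: integral_to_giry[OF \<rho> v] V.ev_mean_mult[OF \<rho> u])
    also have "\<dots> = emeasure (to_giry \<Omega> (codensity_mult functor_V \<Omega> \<rho>)) A"
      by (rule emeasure_to_giry[OF V.codensity_mult_in_space[OF \<rho>] A, symmetric])
    finally show "emeasure (to_giry \<Omega> (codensity_mult functor_V \<Omega> \<rho>)) A = emeasure (giry_mult ?D) A"
      by simp
  qed
qed

section \<open>Assembly of the two isomorphisms of monads\<close>

theorem theorem5p8:
  fixes \<Omega> :: "'a measure" and \<Omega>' :: "'b measure"
  shows
    "(meas_iso (codensity functor_U \<Omega>) (fin_giry \<Omega>) (to_fin_giry \<Omega>) \<and>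
      (\<forall>g \<in> meas_hom \<Omega> \<Omega>'. \<forall>t \<in> space (codensity functor_U \<Omega>).
         to_fin_giry \<Omega>' (codensity_map functor_U \<Omega> \<Omega>' g t) =
         fin_giry_map \<Omega> \<Omega>' g (to_fin_giry \<Omega> t)) \<and>
      (\<forall>\<omega> \<in> space \<Omega>.
         to_fin_giry \<Omega> (codensity_unit functor_U \<Omega> \<omega>) = fin_giry_unit \<Omega> \<omega>) \<and>
      (\<forall>\<rho> \<in> space (codensity functor_U (codensity functor_U \<Omega>)).
         to_fin_giry \<Omega> (codensity_mult functor_U \<Omega> \<rho>) =
         fin_giry_mult \<Omega>
           (fin_giry_map (codensity functor_U \<Omega>) (fin_giry \<Omega>) (to_fin_giry \<Omega>)
             (to_fin_giry (codensity functor_U \<Omega>) \<rho>))))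
     \<and>
     (meas_iso (codensity functor_V \<Omega>) (prob_algebra \<Omega>) (to_giry \<Omega>) \<and>
      (\<forall>g \<in> meas_hom \<Omega> \<Omega>'. \<forall>t \<in> space (codensity functor_V \<Omega>).
         to_giry \<Omega>' (codensity_map functor_V \<Omega> \<Omega>' g t) = distr (to_giry \<Omega> t) \<Omega>' g) \<and>
      (\<forall>\<omega> \<in> space \<Omega>.
         to_giry \<Omega> (codensity_unit functor_V \<Omega> \<omega>) = return \<Omega> \<omega>) \<and>
      (\<forall>\<rho> \<in> space (codensity functor_V (codensity functor_V \<Omega>)).
         to_giry \<Omega> (codensity_mult functor_V \<Omega> \<rho>) =
         giry_mult
           (distr (to_giry (codensity functor_V \<Omega>) \<rho>) (prob_algebra \<Omega>) (to_giry \<Omega>))))"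
  by (intro conjI ballI)
    (simp_all add: to_fin_giry_iso to_fin_giry_natural to_fin_giry_unit to_fin_giry_mult
      to_giry_iso to_giry_natural to_giry_unit to_giry_mult)

end
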